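(* Let $\mathcal{S}_1$ and $\mathcal{S}_2$ be two (indexed) finite sets of Pauli strings, each with $n$ elements, having the same frustration graph on the vertex set $\{1,\dots,n\}$. Then for every ellipsoid $\mathcal{E}_r(w)\subset\mathbb{R}^n$, with $r\ge 0$ and $w=(w_1,\dots,w_n)$ a positive weight vector, $$\mathcal{E}_r(w)\supseteq J(\mathcal{S}_1)\quad\text{if and only if}\quad \mathcal{E}_r(w)\supseteq J(\mathcal{S}_2).$$
   Context: A Pauli string is a tensor product of finitely many of the matrices $\mathbb{I},X,Y,Z$ (identity and Pauli matrices), acting on a multi-qubit Hilbert space. $\mathcal{S}_1$ and $\mathcal{S}_2$ may act on different numbers of qubits. Any two Pauli strings (on the same qubits) either commute or anti-commute. The frustration graph of $\mathcal{S}=\{S_1,\dots,S_n\}$ is the graph on $\{1,\dots,n\}$ in which $i\neq j$ are adjacent iff $S_i$ and $S_j$ anti-commute. For $\mathcal{S}=\{S_1,\dots,S_n\}$ acting on a Hilbert space $\mathcal{H}$, $J(\mathcal{S})=\{(\langle S_1\rangle_\rho,\dots,\langle S_n\rangle_\rho) : \rho\in\mathcal{D}(\mathcal{H})\}\subset\mathbb{R}^n$, where $\langle S\rangle_\rho=\operatorname{Tr}(\rho S)$ and $\mathcal{D}(\mathcal{H})$ is the set of density matrices (positive semidefinite, unit trace) on $\mathcal{H}$. $\mathcal{E}_r(w)$ is the (solid, origin-centred, axis-aligned) ellipsoid with principal axes of length $r/\sqrt{w_i}$, i.e. $\mathcal{E}_r(w)=\{x\in\mathbb{R}^n:\sum_i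 w_i x_i^2\le r^2\}$. *)

theory Defs
  imports "Jordan_Normal_Form.Schur_Decomposition"
begin

section \<open>Pauli strings\<close>

definition pauli_X :: "complex mat" where
  "pauli_X = mat_of_rows_list 2 [[0, 1], [1, 0]]"

definition pauli_Y :: "complex mat" where
  "pauli_Y = mat_of_rows_list 2 [[0, - \<i>], [\<i>, 0]]"

definition pauli_Z :: "complex mat" where
  "pauli_Z = mat_of_rows_list 2 [[1, 0], [0, - 1]]"

definition kron :: "'a :: times mat \<Rightarrow> 'a mat \<Rightarrow> 'a mat" where
  "kron A B = mat (dim_row A * dim_row B) (dim_col A * dim_col B)
     (\<lambda>(i, j). A $$ (i div dim_row B, j div dim_col B) * B $$ (i mod dim_row B, j mod dim_col B))"

definition kron_list :: "complex mat list \<Rightarrow> complex mat" where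
  "kron_list Ps = foldr kron Ps (1\<^sub>m 1)"

text \<open>A Pauli string on \<open>q\<close> qubits is a matrix acting on \<open>\<complex>\<^bsup>2^q\<^esup>\<close>; there are no
  phase factors.\<close>

definition pauli_strings :: "nat \<Rightarrow> complex mat set" where
  "pauli_strings q =
     {kron_list Ps | Ps. length Ps = q \<and> set Ps \<subseteq> {1\<^sub>m 2, pauli_X, pauli_Y, pauli_Z}}"

section \<open>Frustration graph\<close>

definition anticommute :: "'a :: ring mat \<Rightarrow> 'a mat \<Rightarrow> bool" where
  "anticommute A B \<longleftrightarrow> A * B = - (B * A)"

text \<open>The graph is given as the pair of its vertex set and its set of edges. The entry \<open>S ! i\<close>
  of an indexed family plays the role of \<open>S\<^bsub>i+1\<^esub>\<close>, so the vertices are \<open>0, \<dots>, n - 1\<close>.\<close>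

definition frustration_graph :: "'a :: ring mat list \<Rightarrow> nat set \<times> nat set set" where
  "frustration_graph S =
     ({..<length S},
      {{i, j} | i j. i < length S \<and> j < length S \<and> i \<noteq> j \<and> anticommute (S ! i) (S ! j)})"

section \<open>Joint expectation values\<close>

definition mat_trace :: "'a :: comm_monoid_add mat \<Rightarrow> 'a" where
  "mat_trace A = (\<Sum>i<dim_row A. A $$ (i, i))"

text \<open>The order on \<^typ>\<open>complex\<close> is such that \<open>0 \<le> z\<close> means that \<open>z\<close> is real and
  nonnegative.\<close>

definition positive_semidefinite :: "complex mat \<Rightarrow> bool" where
  "positive_semidefinite A \<longleftrightarrow>
     square_mat A \<and> mat_adjoint A = A \<and>
     (\<forall>v \<in> carrier_vec (dim_row A). 0 \<le> (A *\<^sub>v v) \<bullet>c v)"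

definition density_matrices :: "nat \<Rightarrow> complex mat set" where
  "density_matrices d =
     {\<rho> \<in> carrier_mat d d. positive_semidefinite \<rho> \<and> mat_trace \<rho> = 1}"

text \<open>For a density matrix and a Hermitian observable, such as a Pauli string, the trace of the
  product is real, so that taking the real part is only a change of type.\<close>

definition expectation_value :: "complex mat \<Rightarrow> complex mat \<Rightarrow> real" where
  "expectation_value \<rho> A = Re (mat_trace (\<rho> * A))"

text \<open>The parameter \<open>q\<close> is the number of qubits; it cannot be recovered from an empty family.\<close>

definition joint_expectations :: "nat \<Rightarrow> complex mat list \<Rightarrow> real vec set" where
  "joint_expectations q S =
     {vec (length S) (\<lambda>i. expectation_value \<rho> (S ! i)) | \<rho>. \<rho> \<in> density_matrices (2 ^ q)}"

section \<open>Ellipsoids\<close>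

definition ellipsoid :: "real \<Rightarrow> real vec \<Rightarrow> real vec set" where
  "ellipsoid r w =
     {x \<in> carrier_vec (dim_vec w). (\<Sum>i<dim_vec w. w $ i * (x $ i)\<^sup>2) \<le> r\<^sup>2}"

end

theory Submission
  imports Defs
begin

text \<open>Write \<open>q = \<Sum>\<^sub>i w\<^sub>i x\<^sub>i\<^sup>2\<close> for a point \<open>x\<close> of the second set of expectations, attained
  at \<open>\<rho>\<close>; then \<open>q\<close> is the expectation of \<open>H = \<Sum>\<^sub>i a\<^sub>i S\<^sub>i\<close> with \<open>a\<^sub>i = w\<^sub>i x\<^sub>i\<close>. Consider all sign
  flips \<open>H\<^sub>E\<close> of \<open>H\<close> and the sum of \<open>tr H\<^sub>E\<^sup>p\<close> over \<open>E\<close>. Expanding into words in the \<open>S\<^sub>i\<close>, only the words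
  in which every letter occurs an even number of times survive, and such a word is \<open>\<plusminus>1\<close> with a sign
  that is read off the frustration graph. Hence, up to the dimensions, this sum is the same for both
  families. For \<open>p = 2\<^sup>m\<close> it is at least a constant times \<open>q\<^sup>p\<close>. If \<open>r\<^sup>2 < q\<close>, then on the side of
  the first family the containment gives \<open>|tr (\<sigma> H\<^sub>E)| \<le> M = (q + r\<^sup>2) / 2 < q\<close> for all density matrices
  \<open>\<sigma>\<close>, so the sum is at most a constant times \<open>M\<^sup>p\<close>, which is absurd for large \<open>p\<close>.\<close>

section \<open>Traces and positive semidefinite matrices\<close>

lemma mat_trace_mult:
  assumes "A \<in> carrier_mat n m" "B \<in> carrier_mat m n"
  shows "mat_trace (A * B) = (\<Sum>i<n. \<Sum>j<m. A $$ (i, j) * B $$ (j, i))"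
  using assms by (auto simp: mat_trace_def scalar_prod_def lessThan_atLeast0 intro!: sum.cong)

lemma mat_trace_mult_commute:
  fixes A B :: "'a :: comm_semiring_0 mat"
  assumes "A \<in> carrier_mat n m" "B \<in> carrier_mat m n"
  shows "mat_trace (A * B) = mat_trace (B * A)"
  unfolding mat_trace_mult[OF assms] mat_trace_mult[OF assms(2,1)]
  by (subst sum.swap) (simp add: mult.commute)

lemma mat_trace_add:
  assumes "A \<in> carrier_mat n n" "B \<in> carrier_mat n n"
  shows "mat_trace (A + B) = mat_trace A + mat_trace B"
  using assms by (auto simp: mat_trace_def sum.distrib)

lemma mat_trace_minus:
  fixes A B :: "'a :: ab_group_add mat"
  assumes "A \<in> carrier_mat n n" "B \<in> carrier_mat n n"
  shows "mat_trace (A - B) = mat_trace A - mat_trace B"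
  using assms by (auto simp: mat_trace_def sum_subtractf)

lemma mat_trace_smult:
  fixes A :: "'a :: semiring_0 mat"
  assumes "A \<in> carrier_mat n n"
  shows "mat_trace (c \<cdot>\<^sub>m A) = c * mat_trace A"
  using assms by (auto simp: mat_trace_def sum_distrib_left)

lemma mat_trace_one: "mat_trace (1\<^sub>m n :: 'a :: semiring_1 mat) = of_nat n"
  by (simp add: mat_trace_def)

lemma mat_adjoint_index:
  assumes "i < dim_col A" "j < dim_row A"
  shows "mat_adjoint A $$ (i, j) = conjugate (A $$ (j, i))"
  using assms by (simp add: mat_adjoint_def mat_of_rows_def)

lemma mat_adjoint_dim [simp]:
  "dim_row (mat_adjoint A) = dim_col A" "dim_col (mat_adjoint A) = dim_row A"
  by (auto simp: mat_adjoint_def)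

section \<open>Hermitian matrices and their powers\<close>

definition hermitian_mats :: "nat \<Rightarrow> complex mat set" where
  "hermitian_mats d = {A \<in> carrier_mat d d. mat_adjoint A = A}"

lemma hermitian_matsI:
  assumes "A \<in> carrier_mat d d" "\<And>i j. i < d \<Longrightarrow> j < d \<Longrightarrow> A $$ (i, j) = cnj (A $$ (j, i))"
  shows "A \<in> hermitian_mats d"
proof -
  have "mat_adjoint A = A"
    using assms(1) by (intro eq_matI) (auto simp: mat_adjoint_index assms(2)[symmetric])
  with assms(1) show ?thesis by (simp add: hermitian_mats_def)
qed

lemma hermitian_mats_index:
  assumes "A \<in> hermitian_mats d" "i < d" "j < d"
  shows "A $$ (i, j) = cnj (A $$ (j, i))"
proof -
  have "A $$ (i, j) = mat_adjoint A $$ (i, j)" "A \<in> carrier_mat d d"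
    using assms by (auto simp: hermitian_mats_def)
  with assms show ?thesis by (auto simp: mat_adjoint_index)
qed

lemma hermitian_mats_carrier: "A \<in> hermitian_mats d \<Longrightarrow> A \<in> carrier_mat d d"
  by (simp add: hermitian_mats_def)

lemma hermitian_mats_one: "1\<^sub>m d \<in> hermitian_mats d"
  by (rule hermitian_matsI) auto

lemma hermitian_mats_add:
  assumes "A \<in> hermitian_mats d" "B \<in> hermitian_mats d"
  shows "A + B \<in> hermitian_mats d"
  using assms hermitian_mats_carrier[OF assms(1)] hermitian_mats_carrier[OF assms(2)]
  by (intro hermitian_matsI) (auto simp: hermitian_mats_index[of _ d, symmetric])

lemma hermitian_mats_minus:
  assumes "A \<in> hermitian_mats d" "B \<in> hermitian_mats d"
  shows "A - B \<in> hermitian_mats d"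
  using assms hermitian_mats_carrier[OF assms(1)] hermitian_mats_carrier[OF assms(2)]
  by (intro hermitian_matsI) (auto simp: hermitian_mats_index[of _ d, symmetric])

lemma hermitian_mats_smult:
  assumes "A \<in> hermitian_mats d"
  shows "complex_of_real c \<cdot>\<^sub>m A \<in> hermitian_mats d"
  using assms hermitian_mats_carrier[OF assms(1)]
  by (intro hermitian_matsI) (auto simp: hermitian_mats_index[of _ d, symmetric])

lemma hermitian_mats_mult:
  assumes "A \<in> hermitian_mats d" "B \<in> hermitian_mats d" "A * B = B * A"
  shows "A * B \<in> hermitian_mats d"
proof (rule hermitian_matsI)
  note cA = hermitian_mats_carrier[OF assms(1)] and cB = hermitian_mats_carrier[OF assms(2)]
  show "A * B \<in> carrier_mat d d" using cA cB by auto
  fix i j assume ij: "i < d" "j < d"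
  have "cnj ((A * B) $$ (j, i)) = (\<Sum>k<d. cnj (A $$ (j, k)) * cnj (B $$ (k, i)))"
    using cA cB ij by (auto simp: scalar_prod_def lessThan_atLeast0)
  also have "\<dots> = (\<Sum>k<d. B $$ (i, k) * A $$ (k, j))"
    using ij by (auto simp: hermitian_mats_index[OF assms(1), symmetric]
        hermitian_mats_index[OF assms(2), symmetric] mult.commute intro!: sum.cong)
  also have "\<dots> = (B * A) $$ (i, j)"
    using cA cB ij by (auto simp: scalar_prod_def lessThan_atLeast0)
  finally show "(A * B) $$ (i, j) = cnj ((A * B) $$ (j, i))" using assms(3) by simp
qed

lemma pow_mat_add:
  assumes "A \<in> carrier_mat n n"
  shows "A ^\<^sub>m (k + l) = A ^\<^sub>m k * A ^\<^sub>m l"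
proof (induction l)
  case 0
  then show ?case using assms by (simp add: right_mult_one_mat[of _ n n])
next
  case (Suc l)
  have "A ^\<^sub>m k * A ^\<^sub>m l * A = A ^\<^sub>m k * (A ^\<^sub>m l * A)"
    using assms by (intro assoc_mult_mat) auto
  with Suc show ?case by simp
qed

lemma pow_mat_Suc_left:
  assumes "A \<in> carrier_mat n n"
  shows "A ^\<^sub>m Suc k = A * A ^\<^sub>m k"
  using pow_mat_add[OF assms, of 1 k] assms by simp

lemma hermitian_mats_pow:
  assumes "A \<in> hermitian_mats d"
  shows "A ^\<^sub>m k \<in> hermitian_mats d"
proof (induction k)
  case 0
  then show ?case using hermitian_mats_carrier[OF assms] hermitian_mats_one by simp
next
  case (Suc k)
  then show ?case
    using assms pow_mat_Suc_left[OF hermitian_mats_carrier[OF assms], of k]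
    by (auto intro!: hermitian_mats_mult)
qed

lemma pow_mat_double:
  assumes "A \<in> carrier_mat n n"
  shows "A ^\<^sub>m (2 ^ Suc m) = A ^\<^sub>m (2 ^ m) * A ^\<^sub>m (2 ^ m)"
  using pow_mat_add[OF assms, of "2 ^ m" "2 ^ m"] by (simp add: mult_2)

section \<open>The cone of positive semidefinite matrices\<close>

definition psd_mats :: "nat \<Rightarrow> complex mat set" where
  "psd_mats d = {A \<in> carrier_mat d d. positive_semidefinite A}"

lemma psd_mats_carrier: "A \<in> psd_mats d \<Longrightarrow> A \<in> carrier_mat d d"
  by (simp add: psd_mats_def)

lemma psd_mats_iff:
  "A \<in> psd_mats d \<longleftrightarrow> A \<in> hermitian_mats d \<and> (\<forall>v \<in> carrier_vec d. 0 \<le> (A *\<^sub>v v) \<bullet>c v)"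
  by (auto simp: psd_mats_def hermitian_mats_def positive_semidefinite_def)

lemma psd_mats_one: "1\<^sub>m d \<in> psd_mats d"
  by (auto simp: psd_mats_iff hermitian_mats_one)

lemma psd_mats_add:
  assumes "A \<in> psd_mats d" "B \<in> psd_mats d"
  shows "A + B \<in> psd_mats d"
proof -
  note c = psd_mats_carrier[OF assms(1)] psd_mats_carrier[OF assms(2)]
  have "((A + B) *\<^sub>v v) \<bullet>c v = (A *\<^sub>v v) \<bullet>c v + (B *\<^sub>v v) \<bullet>c v" if "v \<in> carrier_vec d" for v
    using that c mult_mat_vec_carrier[OF c(1) that] mult_mat_vec_carrier[OF c(2) that]
    by (simp add: add_mult_distrib_mat_vec[of _ d d] add_scalar_prod_distrib[of _ d])
  with assms show ?thesis by (auto simp: psd_mats_iff hermitian_mats_add)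
qed

lemma psd_mats_smult:
  assumes "A \<in> psd_mats d" "c \<ge> 0"
  shows "complex_of_real c \<cdot>\<^sub>m A \<in> psd_mats d"
proof -
  have A: "A \<in> hermitian_mats d" "\<And>v. v \<in> carrier_vec d \<Longrightarrow> 0 \<le> (A *\<^sub>v v) \<bullet>c v"
    using assms by (auto simp: psd_mats_iff)
  have "(complex_of_real c \<cdot>\<^sub>m A) *\<^sub>v v = complex_of_real c \<cdot>\<^sub>v (A *\<^sub>v v)" if "v \<in> carrier_vec d" for v
    using that hermitian_mats_carrier[OF A(1)]
    by (auto intro!: eq_vecI)
  moreover have "(complex_of_real c \<cdot>\<^sub>v (A *\<^sub>v v)) \<bullet>c v = complex_of_real c * ((A *\<^sub>v v) \<bullet>c v)"
    if "v \<in> carrier_vec d" for v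
    using that hermitian_mats_carrier[OF A(1)] by (auto simp: smult_scalar_prod_distrib[of _ d])
  ultimately show ?thesis
    using A assms(2) by (auto simp: psd_mats_iff hermitian_mats_smult less_eq_complex_def)
qed

lemma hermitian_mats_sprod:
  assumes "B \<in> hermitian_mats d" "v \<in> carrier_vec d" "w \<in> carrier_vec d"
  shows "(B *\<^sub>v w) \<bullet>c v = w \<bullet>c (B *\<^sub>v v)"
proof -
  note cB = hermitian_mats_carrier[OF assms(1)]
  have "(B *\<^sub>v w) \<bullet>c v = (\<Sum>i<d. \<Sum>j<d. B $$ (i, j) * w $ j * cnj (v $ i))"
    using cB assms(2,3)
    by (auto simp: scalar_prod_def lessThan_atLeast0 sum_distrib_right intro!: sum.cong)
  also have "\<dots> = (\<Sum>j<d. \<Sum>i<d. B $$ (i, j) * w $ j * cnj (v $ i))"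
    by (rule sum.swap)
  also have "\<dots> = (\<Sum>j<d. \<Sum>i<d. w $ j * cnj (B $$ (j, i) * v $ i))"
    by (intro sum.cong) (auto simp: hermitian_mats_index[OF assms(1), symmetric])
  also have "\<dots> = w \<bullet>c (B *\<^sub>v v)"
    using cB assms(2,3)
    by (auto simp: scalar_prod_def lessThan_atLeast0 sum_distrib_left intro!: sum.cong)
  finally show ?thesis .
qed

lemma unit_vec_sprod:
  fixes A :: "complex mat"
  assumes "A \<in> carrier_mat d d" "k < d" "l < d"
  shows "(A *\<^sub>v unit_vec d l) \<bullet>c unit_vec d k = A $$ (k, l)"
proof -
  have "conjugate (unit_vec d k :: complex vec) = unit_vec d k"
    by (auto intro!: eq_vecI simp: unit_vec_def)
  with assms show ?thesis by simp
qed

text \<open>Moving the left factor \<open>B\<close> to the other side of the inner product turns the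
  form of \<open>B * A * B\<close> at \<open>v\<close> into the form of \<open>A\<close> at
  \<open>B *\<^sub>v v\<close>. Applied to a state, conjugation gives a positive matrix whose trace
  need not be 1, which is why later bounds are stated on the whole cone and not only for density
  matrices.\<close>

lemma psd_mats_conjugation:
  assumes A: "A \<in> psd_mats d" and B: "B \<in> hermitian_mats d"
  shows "B * A * B \<in> psd_mats d"
proof -
  have A': "A \<in> hermitian_mats d" "\<And>v. v \<in> carrier_vec d \<Longrightarrow> 0 \<le> (A *\<^sub>v v) \<bullet>c v"
    using A by (auto simp: psd_mats_iff)
  note cA = hermitian_mats_carrier[OF A'(1)] and cB = hermitian_mats_carrier[OF B]
  have cBAB: "B * A * B \<in> carrier_mat d d" using cA cB by auto
  have apply_BAB: "(B * A * B) *\<^sub>v v = B *\<^sub>v (A *\<^sub>v (B *\<^sub>v v))" if "v \<in> carrier_vec d" for v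
    using that cA cB by (simp add: assoc_mult_mat_vec[of _ d d _ d])
  have sprod: "((B * A * B) *\<^sub>v v) \<bullet>c w = (A *\<^sub>v (B *\<^sub>v v)) \<bullet>c (B *\<^sub>v w)"
    if "v \<in> carrier_vec d" "w \<in> carrier_vec d" for v w
    using that cA cB apply_BAB[of v] hermitian_mats_sprod[OF B, of w] by simp
  have "B * A * B \<in> hermitian_mats d"
  proof (rule hermitian_matsI[OF cBAB])
    fix i j assume ij: "i < d" "j < d"
    have "(B * A * B) $$ (i, j) =
        (A *\<^sub>v (B *\<^sub>v unit_vec d j)) \<bullet>c (B *\<^sub>v unit_vec d i)"
      using ij by (simp add: unit_vec_sprod[OF cBAB, symmetric] sprod)
    also have "\<dots> = (B *\<^sub>v unit_vec d j) \<bullet>c (A *\<^sub>v (B *\<^sub>v unit_vec d i))"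
      using cB by (intro hermitian_mats_sprod[OF A'(1)]) auto
    also have "\<dots> = cnj ((A *\<^sub>v (B *\<^sub>v unit_vec d i)) \<bullet>c (B *\<^sub>v unit_vec d j))"
      using cA cB
      by (subst conjugate_vec_sprod_comm[of _ d]) (auto simp: conjugate_sprod_vec[of _ d] simp flip: conjugate_complex_def)
    also have "\<dots> = cnj ((B * A * B) $$ (j, i))"
      using ij by (simp add: unit_vec_sprod[OF cBAB, symmetric] sprod)
    finally show "(B * A * B) $$ (i, j) = cnj ((B * A * B) $$ (j, i))" .
  qed
  with A'(2) sprod cB show ?thesis
    by (auto simp: psd_mats_iff)
qed

lemma psd_mats_trace_nonneg:
  assumes "A \<in> psd_mats d"
  shows "0 \<le> mat_trace A"
proof -
  have A: "A \<in> carrier_mat d d" "\<And>v. v \<in> carrier_vec d \<Longrightarrow> 0 \<le> (A *\<^sub>v v) \<bullet>c v"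
    using assms hermitian_mats_carrier by (auto simp: psd_mats_iff)
  have "0 \<le> A $$ (i, i)" if "i < d" for i
    using A(2)[of "unit_vec d i"] that by (simp add: unit_vec_sprod[OF A(1)])
  with A(1) show ?thesis by (auto simp: mat_trace_def intro!: sum_nonneg)
qed

section \<open>Bounds on expectation values of powers\<close>

text \<open>Cyclicity of the trace: testing \<open>P\<close> on the conjugated state
  \<open>B * \<rho> * B\<close> is testing \<open>B * P * B\<close> on \<open>\<rho>\<close>. Hence
  positivity of \<open>P\<close> on all states passes to \<open>B * P * B\<close>.\<close>

lemma trace_conjugation:
  fixes \<rho> B P :: "'a :: comm_semiring_1 mat"
  assumes "\<rho> \<in> carrier_mat d d" "B \<in> carrier_mat d d" "P \<in> carrier_mat d d"
  shows "mat_trace (B * \<rho> * B * P) = mat_trace (\<rho> * (B * P * B))"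
proof -
  have "B * \<rho> * B * P = B * (\<rho> * (B * P))"
    using assms by (simp add: assoc_mult_mat[of _ d d _ d _ d])
  then have "mat_trace (B * \<rho> * B * P) = mat_trace (\<rho> * (B * P) * B)"
    using assms by (simp add: mat_trace_mult_commute[of B d d])
  also have "\<rho> * (B * P) * B = \<rho> * (B * P * B)"
    using assms by (intro assoc_mult_mat[of _ d d _ d _ d]) auto
  finally show ?thesis .
qed

lemma expectation_square_nonneg:
  assumes "\<rho> \<in> psd_mats d" "B \<in> hermitian_mats d"
  shows "0 \<le> expectation_value \<rho> (B * B)"
proof -
  note c = psd_mats_carrier[OF assms(1)] hermitian_mats_carrier[OF assms(2)]
  have "0 \<le> mat_trace (B * \<rho> * B)"
    by (rule psd_mats_trace_nonneg[OF psd_mats_conjugation[OF assms]])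
  also have "\<dots> = mat_trace (\<rho> * (B * B))"
    using trace_conjugation[of \<rho> d B "1\<^sub>m d"] c by simp
  finally show ?thesis by (simp add: expectation_value_def less_eq_complex_def)
qed

lemma expectation_add:
  assumes "\<rho> \<in> carrier_mat d d" "A \<in> carrier_mat d d" "B \<in> carrier_mat d d"
  shows "expectation_value \<rho> (A + B) = expectation_value \<rho> A + expectation_value \<rho> B"
  using assms by (simp add: expectation_value_def mult_add_distrib_mat[of _ d d _ d] mat_trace_add[of _ d])

lemma expectation_minus:
  assumes "\<rho> \<in> carrier_mat d d" "A \<in> carrier_mat d d" "B \<in> carrier_mat d d"
  shows "expectation_value \<rho> (A - B) = expectation_value \<rho> A - expectation_value \<rho> B"
  using assms by (simp add: expectation_value_def mult_minus_distrib_mat[of _ d d _ d] mat_trace_minus[of _ d])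

lemma expectation_smult:
  assumes "\<rho> \<in> carrier_mat d d" "A \<in> carrier_mat d d"
  shows "expectation_value \<rho> (complex_of_real c \<cdot>\<^sub>m A) = c * expectation_value \<rho> A"
  using assms by (simp add: expectation_value_def mult_smult_distrib[of _ d d _ d] mat_trace_smult[of _ d])

lemma expectation_one:
  assumes "\<rho> \<in> carrier_mat d d"
  shows "expectation_value \<rho> (1\<^sub>m d) = Re (mat_trace \<rho>)"
  using assms by (simp add: expectation_value_def)

lemma density_matrices_iff: "\<rho> \<in> density_matrices d \<longleftrightarrow> \<rho> \<in> psd_mats d \<and> mat_trace \<rho> = 1"
  by (auto simp: density_matrices_def psd_mats_def)

text \<open>The variance is nonnegative: expand the expectation of \<open>(H - E) * (H - E)\<close>,
  where \<open>E\<close> is the expectation of \<open>H\<close> times the identity, and use that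
  \<open>\<rho>\<close> has trace 1.\<close>

lemma expectation_square_ge:
  assumes "\<rho> \<in> density_matrices d" "H \<in> hermitian_mats d"
  shows "(expectation_value \<rho> H)\<^sup>2 \<le> expectation_value \<rho> (H * H)"
proof -
  define e where "e = expectation_value \<rho> H"
  define E where "E = complex_of_real e \<cdot>\<^sub>m 1\<^sub>m d"
  have \<rho>: "\<rho> \<in> psd_mats d" "mat_trace \<rho> = 1" using assms(1) by (auto simp: density_matrices_iff)
  note c = psd_mats_carrier[OF \<rho>(1)] hermitian_mats_carrier[OF assms(2)]
  have E: "E \<in> hermitian_mats d" "E \<in> carrier_mat d d"
    unfolding E_def using hermitian_mats_smult[OF hermitian_mats_one] by auto
  have EH: "E * H = complex_of_real e \<cdot>\<^sub>m H" "H * E = complex_of_real e \<cdot>\<^sub>m H"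
    using c unfolding E_def
    by (auto simp: mult_smult_assoc_mat[of _ d d _ d] mult_smult_distrib[of _ d d _ d])
  have EE: "E * E = complex_of_real (e\<^sup>2) \<cdot>\<^sub>m 1\<^sub>m d"
    unfolding E_def by (auto simp: mult_smult_assoc_mat[of _ d d _ d] mult_smult_distrib[of _ d d _ d]
        power2_eq_square)
  have cHE: "H - E \<in> carrier_mat d d" using E(2) by (rule minus_carrier_mat)
  have "(H - E) * (H - E) = (H - E) * H - (H - E) * E"
    using c E cHE by (intro mult_minus_distrib_mat[of _ d d _ d]) auto
  also have "\<dots> = (H * H - E * H) - (H * E - E * E)"
    using c E by (simp only: minus_mult_distrib_mat[of H d d E H d] minus_mult_distrib_mat[of H d d E E d])
  finally have "(H - E) * (H - E) = (H * H - complex_of_real e \<cdot>\<^sub>m H) - (complex_of_real e \<cdot>\<^sub>m H - complex_of_real (e\<^sup>2) \<cdot>\<^sub>m 1\<^sub>m d)"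
    by (simp only: EH EE)
  moreover have "0 \<le> expectation_value \<rho> ((H - E) * (H - E))"
    using expectation_square_nonneg[OF \<rho>(1)] hermitian_mats_minus[OF assms(2) E(1)] by blast
  ultimately have "0 \<le> expectation_value \<rho> (H * H) - e * e - (e * e - e\<^sup>2)"
    using c \<rho>(2) by (simp only: expectation_minus[of _ d] expectation_smult[of _ d] expectation_one[of _ d]
        mult_carrier_mat[of _ d d] minus_carrier_mat smult_carrier_mat one_carrier_mat
        e_def[symmetric]) simp
  then show ?thesis unfolding e_def by (simp add: power2_eq_square)
qed

text \<open>Each doubling of the exponent is one application of the variance inequality to a power
  of \<open>H\<close>. Nonnegativity of the expectation is what allows the inductive inequality to
  be squared.\<close>

lemma expectation_power_ge:
  assumes "\<rho> \<in> density_matrices d" "H \<in> hermitian_mats d" "0 \<le> expectation_value \<rho> H"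
  shows "(expectation_value \<rho> H) ^ (2 ^ m) \<le> expectation_value \<rho> (H ^\<^sub>m (2 ^ m))"
proof (induction m)
  case 0
  then show ?case using hermitian_mats_carrier[OF assms(2)] by simp
next
  case (Suc m)
  have "(expectation_value \<rho> H) ^ (2 ^ Suc m) = ((expectation_value \<rho> H) ^ (2 ^ m))\<^sup>2"
    by (simp add: power_mult[symmetric] mult.commute)
  also have "\<dots> \<le> (expectation_value \<rho> (H ^\<^sub>m (2 ^ m)))\<^sup>2"
    using Suc assms(3) by (intro power_mono) auto
  also have "\<dots> \<le> expectation_value \<rho> (H ^\<^sub>m (2 ^ m) * H ^\<^sub>m (2 ^ m))"
    using assms by (intro expectation_square_ge hermitian_mats_pow)
  finally show ?case using pow_mat_double[OF hermitian_mats_carrier[OF assms(2)]] by simp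
qed

text \<open>The right-hand side is the squared Frobenius norm. So the trace of an even power of a
  Hermitian matrix is nonnegative and controls all entries of the half power.\<close>

lemma hermitian_trace_square:
  assumes "B \<in> hermitian_mats d"
  shows "mat_trace (B * B) = complex_of_real (\<Sum>i<d. \<Sum>j<d. (cmod (B $$ (i, j)))\<^sup>2)"
proof -
  have "B $$ (i, j) * B $$ (j, i) = complex_of_real ((cmod (B $$ (i, j)))\<^sup>2)" if "i < d" "j < d" for i j
    using hermitian_mats_index[OF assms that(2,1)] complex_norm_square[of "B $$ (i, j)"] by simp
  then show ?thesis
    using hermitian_mats_carrier[OF assms] by (simp add: mat_trace_mult[of _ d d])
qed

text \<open>The squared Frobenius norm of \<open>B\<close> bounds every entry of
  \<open>B * B\<close>, and summing against the entries of \<open>\<rho>\<close> leaves a constant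
  that depends on \<open>\<rho>\<close> alone. Its size does not matter: later it is a fixed factor
  against exponential growth.\<close>

lemma expectation_square_le_trace:
  assumes "\<rho> \<in> carrier_mat d d"
  obtains C where "C \<ge> 0"
    "\<And>B. B \<in> hermitian_mats d \<Longrightarrow> expectation_value \<rho> (B * B) \<le> C * Re (mat_trace (B * B))"
proof
  define C where "C = (\<Sum>i<d. \<Sum>j<d. cmod (\<rho> $$ (i, j)))"
  show "C \<ge> 0" unfolding C_def by (intro sum_nonneg) auto
  fix B assume B: "B \<in> hermitian_mats d"
  define T where "T = Re (mat_trace (B * B))"
  have cB: "B \<in> carrier_mat d d" using B by (rule hermitian_mats_carrier)
  have T: "T = (\<Sum>i<d. \<Sum>j<d. (cmod (B $$ (i, j)))\<^sup>2)"
    unfolding T_def hermitian_trace_square[OF B] by simp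
  have row: "(\<Sum>k<d. (cmod (B $$ (i, k)))\<^sup>2) \<le> T" if "i < d" for i
    unfolding T using that by (intro member_le_sum) (auto intro!: sum_nonneg)
  \<comment> \<open>An entry of \<open>B * B\<close> is a product of two rows of \<open>B\<close>;
    the inequality \<open>2 a b \<le> a\<^sup>2 + b\<^sup>2\<close> bounds it by the mean of their
    squared norms, each at most \<open>T\<close>.\<close>
  have entry: "cmod ((B * B) $$ (j, i)) \<le> T" if "i < d" "j < d" for i j
  proof -
    have "cmod ((B * B) $$ (j, i)) = cmod (\<Sum>k<d. B $$ (j, k) * B $$ (k, i))"
      using cB that by (simp add: scalar_prod_def lessThan_atLeast0)
    also have "\<dots> \<le> (\<Sum>k<d. cmod (B $$ (j, k)) * cmod (B $$ (i, k)))"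
    proof (intro order_trans[OF norm_sum] sum_mono)
      fix k assume "k \<in> {..<d}"
      then have "cmod (B $$ (k, i)) = cmod (B $$ (i, k))"
        using hermitian_mats_index[OF B, of k i] that by simp
      then show "cmod (B $$ (j, k) * B $$ (k, i)) \<le> cmod (B $$ (j, k)) * cmod (B $$ (i, k))"
        by (simp add: norm_mult)
    qed
    also have "\<dots> \<le> (\<Sum>k<d. ((cmod (B $$ (j, k)))\<^sup>2 + (cmod (B $$ (i, k)))\<^sup>2) / 2)"
    proof (intro sum_mono)
      fix k
      show "cmod (B $$ (j, k)) * cmod (B $$ (i, k)) \<le> ((cmod (B $$ (j, k)))\<^sup>2 + (cmod (B $$ (i, k)))\<^sup>2) / 2"
        using sum_squares_bound[of "cmod (B $$ (j, k))" "cmod (B $$ (i, k))"] by simp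
    qed
    also have "\<dots> = ((\<Sum>k<d. (cmod (B $$ (j, k)))\<^sup>2) + (\<Sum>k<d. (cmod (B $$ (i, k)))\<^sup>2)) / 2"
      by (simp add: sum.distrib add_divide_distrib sum_divide_distrib)
    also have "\<dots> \<le> T" using row[OF that(1)] row[OF that(2)] by simp
    finally show ?thesis .
  qed
  have "expectation_value \<rho> (B * B) \<le> cmod (mat_trace (\<rho> * (B * B)))"
    unfolding expectation_value_def by (rule complex_Re_le_cmod)
  also have "\<dots> \<le> (\<Sum>i<d. \<Sum>j<d. cmod (\<rho> $$ (i, j)) * T)"
    unfolding mat_trace_mult[OF assms mult_carrier_mat[OF cB cB]]
    using entry
    by (intro order_trans[OF norm_sum] sum_mono order_trans[OF norm_sum])
       (auto simp: norm_mult intro!: mult_left_mono)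
  also have "\<dots> = C * T" by (simp add: C_def sum_distrib_right)
  finally show "expectation_value \<rho> (B * B) \<le> C * Re (mat_trace (B * B))" by (simp add: T_def)
qed

text \<open>Both sides are homogeneous in \<open>\<sigma>\<close>, so one normalises by the trace.
  As the trace may vanish, \<open>\<sigma>\<close> is first shifted by \<open>\<delta>\<close> times
  the identity, whose trace \<open>\<delta> * d\<close> is positive, and then
  \<open>\<delta>\<close> tends to 0.\<close>

lemma density_matrix_bound_imp_psd_bound:
  assumes "d > 0" "H \<in> carrier_mat d d"
    and bound: "\<And>\<rho>. \<rho> \<in> density_matrices d \<Longrightarrow> expectation_value \<rho> H \<le> M"
    and \<sigma>: "\<sigma> \<in> psd_mats d"
  shows "expectation_value \<sigma> H \<le> M * Re (mat_trace \<sigma>)"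
proof -
  define h where "h = Re (mat_trace H)"
  have c\<sigma>: "\<sigma> \<in> carrier_mat d d" using \<sigma> by (rule psd_mats_carrier)
  have \<sigma>0: "0 \<le> Re (mat_trace \<sigma>)" "Im (mat_trace \<sigma>) = 0"
    using psd_mats_trace_nonneg[OF \<sigma>] by (auto simp: less_eq_complex_def)
  have "expectation_value \<sigma> H \<le> M * Re (mat_trace \<sigma>) + \<delta> * (M * d - h)" if "\<delta> > 0" for \<delta>
  proof -
    define t where "t = Re (mat_trace \<sigma>) + \<delta> * d"
    have t: "t > 0" using \<sigma>0(1) that assms(1) unfolding t_def by (simp add: add_nonneg_pos)
    define \<tau> where "\<tau> = \<sigma> + complex_of_real \<delta> \<cdot>\<^sub>m 1\<^sub>m d"
    have c\<tau>: "\<tau> \<in> carrier_mat d d" using c\<sigma> unfolding \<tau>_def by simp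
    have "mat_trace \<tau> = mat_trace \<sigma> + complex_of_real \<delta> * d"
      using c\<sigma> unfolding \<tau>_def by (simp add: mat_trace_add[of _ d] mat_trace_smult[of _ d] mat_trace_one)
    then have tr: "mat_trace \<tau> = complex_of_real t"
      using \<sigma>0(2) unfolding t_def by (simp add: complex_eq_iff)
    have "\<tau> \<in> psd_mats d"
      unfolding \<tau>_def using \<sigma> that by (intro psd_mats_add psd_mats_smult psd_mats_one) auto
    then have "complex_of_real (1 / t) \<cdot>\<^sub>m \<tau> \<in> density_matrices d"
      using psd_mats_smult[of \<tau> d "1 / t"] t c\<tau> tr by (simp add: density_matrices_iff mat_trace_smult[of _ d])
    then have le: "expectation_value (complex_of_real (1 / t) \<cdot>\<^sub>m \<tau>) H \<le> M" by (rule bound)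
    have eq: "expectation_value (complex_of_real (1 / t) \<cdot>\<^sub>m \<tau>) H = expectation_value \<tau> H / t"
      unfolding expectation_value_def using c\<tau> assms(2)
      by (simp only: mult_smult_assoc_mat[of _ d d _ d] mat_trace_smult[of _ d] mult_carrier_mat[of _ d d]) simp
    have "expectation_value \<tau> H \<le> M * t" using le t unfolding eq by (simp add: pos_divide_le_eq)
    moreover have "expectation_value \<tau> H = expectation_value \<sigma> H + \<delta> * h"
      unfolding expectation_value_def \<tau>_def h_def using c\<sigma> assms(2)
      by (simp add: add_mult_distrib_mat[of _ d d _ _ d] mult_smult_assoc_mat[of _ d d _ d]
          mat_trace_add[of _ d] mat_trace_smult[of _ d])
    ultimately show ?thesis unfolding t_def by (simp add: algebra_simps)
  qed
  \<comment> \<open>With the absolute value the coefficient of \<open>\<delta>\<close> is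
    nonnegative, so a small enough \<open>\<delta>\<close> makes the error at most \<open>e\<close>;
    the denominator \<open>K + 1\<close> below avoids division by zero.\<close>
  then have le: "expectation_value \<sigma> H \<le> M * Re (mat_trace \<sigma>) + \<delta> * \<bar>M * d - h\<bar>" if "\<delta> > 0" for \<delta>
    using that by (meson abs_ge_self add_left_mono mult_left_mono order_less_imp_le order_trans)
  show ?thesis
  proof (rule field_le_epsilon)
    fix e :: real assume "e > 0"
    define K where "K = \<bar>M * d - h\<bar>"
    have "K \<ge> 0" by (simp add: K_def)
    then have "e / (K + 1) * K \<le> e" using \<open>e > 0\<close> by (simp add: field_simps)
    moreover have "e / (K + 1) > 0" using \<open>e > 0\<close> \<open>K \<ge> 0\<close> by simp
    ultimately show "expectation_value \<sigma> H \<le> M * Re (mat_trace \<sigma>) + e"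
      using le[of "e / (K + 1)"] unfolding K_def by linarith
  qed
qed

text \<open>With \<open>A = M - H\<close> and \<open>P = M + H\<close>, both positive, one has
  \<open>A P A + P A P = 2 M (M\<^sup>2 - H\<^sup>2)\<close>; so no spectral decomposition of \<open>H\<close> is needed.\<close>

lemma expectation_square_le:
  assumes "M > 0" and H: "H \<in> hermitian_mats d"
    and upper: "\<And>\<rho>. \<rho> \<in> psd_mats d \<Longrightarrow> expectation_value \<rho> H \<le> M * Re (mat_trace \<rho>)"
    and lower: "\<And>\<rho>. \<rho> \<in> psd_mats d \<Longrightarrow> - (M * Re (mat_trace \<rho>)) \<le> expectation_value \<rho> H"
    and \<rho>: "\<rho> \<in> psd_mats d"
  shows "expectation_value \<rho> (H * H) \<le> M\<^sup>2 * Re (mat_trace \<rho>)"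
proof -
  define E where "E = complex_of_real M \<cdot>\<^sub>m 1\<^sub>m d"
  define A where "A = E - H"
  define P where "P = E + H"
  define Q where "Q = complex_of_real (M\<^sup>2) \<cdot>\<^sub>m 1\<^sub>m d - H * H"
  note c\<rho> = psd_mats_carrier[OF \<rho>] and cH = hermitian_mats_carrier[OF H]
  have E: "E \<in> hermitian_mats d" "E \<in> carrier_mat d d"
    unfolding E_def using hermitian_mats_smult[OF hermitian_mats_one] by auto
  have A: "A \<in> hermitian_mats d" "A \<in> carrier_mat d d"
    unfolding A_def using hermitian_mats_minus[OF E(1) H] hermitian_mats_carrier by auto
  have P: "P \<in> hermitian_mats d" "P \<in> carrier_mat d d"
    unfolding P_def using hermitian_mats_add[OF E(1) H] hermitian_mats_carrier by auto
  have cQ: "Q \<in> carrier_mat d d" unfolding Q_def using cH by auto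
  have EH: "E * H = complex_of_real M \<cdot>\<^sub>m H" "H * E = complex_of_real M \<cdot>\<^sub>m H"
    using cH unfolding E_def
    by (auto simp: mult_smult_assoc_mat[of _ d d _ d] mult_smult_distrib[of _ d d _ d])
  have EE: "E * E = complex_of_real (M\<^sup>2) \<cdot>\<^sub>m 1\<^sub>m d"
    unfolding E_def by (auto simp: mult_smult_assoc_mat[of _ d d _ d] mult_smult_distrib[of _ d d _ d]
        power2_eq_square)
  have AP: "A * P = Q" unfolding A_def P_def Q_def
    using cH E by (simp add: mult_add_distrib_mat[of _ d d _ d] minus_mult_distrib_mat[of _ d d _ _ d] EH EE)
      (auto intro!: eq_matI)
  have PA: "P * A = Q" unfolding A_def P_def Q_def
    using cH E by (simp add: mult_minus_distrib_mat[of _ d d _ d] add_mult_distrib_mat[of _ d d _ _ d] EH EE)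
      (auto intro!: eq_matI)
  have "A + P = complex_of_real (2 * M) \<cdot>\<^sub>m 1\<^sub>m d"
    unfolding A_def P_def E_def using cH by (auto intro!: eq_matI)
  then have sum: "A * P * A + P * A * P = complex_of_real (2 * M) \<cdot>\<^sub>m Q"
    using A P cQ by (simp add: AP PA mult_add_distrib_mat[of _ d d _ d, symmetric] mult_smult_distrib[of _ d d _ d])
  \<comment> \<open>The hypotheses \<open>upper\<close> and \<open>lower\<close> say that
    \<open>A\<close> and \<open>P\<close> have nonnegative expectation on the whole cone. This is
    then used at the conjugated states \<open>P * \<rho> * P\<close> and
    \<open>A * \<rho> * A\<close>.\<close>
  have pos: "0 \<le> expectation_value \<sigma> A" "0 \<le> expectation_value \<sigma> P" if "\<sigma> \<in> psd_mats d" for \<sigma>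
    using upper[OF that] lower[OF that] psd_mats_carrier[OF that] cH E(2)
    unfolding A_def P_def
    by (auto simp: expectation_minus[of _ d] expectation_add[of _ d] E_def expectation_smult[of _ d] expectation_one)
  have "0 \<le> expectation_value \<rho> (A * P * A)"
    using pos(2)[OF psd_mats_conjugation[OF \<rho> A(1)]] trace_conjugation[OF c\<rho> A(2) P(2)]
    by (simp add: expectation_value_def)
  moreover have "0 \<le> expectation_value \<rho> (P * A * P)"
    using pos(1)[OF psd_mats_conjugation[OF \<rho> P(1)]] trace_conjugation[OF c\<rho> P(2) A(2)]
    by (simp add: expectation_value_def)
  ultimately have "0 \<le> expectation_value \<rho> (A * P * A + P * A * P)"
    using A P c\<rho> by (simp add: expectation_add[of _ d] mult_carrier_mat[of _ d d])
  then have "0 \<le> expectation_value \<rho> Q"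
    unfolding sum using expectation_smult[OF c\<rho> cQ, of "2 * M"] \<open>M > 0\<close> by (simp add: zero_le_mult_iff)
  then show ?thesis
    unfolding Q_def using c\<rho> cH
    by (simp only: expectation_minus[of _ d] expectation_smult[of _ d] expectation_one[of _ d]
        mult_carrier_mat[of _ d d] smult_carrier_mat one_carrier_mat)
qed

text \<open>The bound on \<open>H\<close> is squared \<open>m\<close> times and finally evaluated at
  the identity matrix, which is positive semidefinite of trace \<open>d\<close>.\<close>

lemma trace_power_le:
  assumes "d > 0" "M > 0" and H: "H \<in> hermitian_mats d"
    and bound: "\<And>\<rho>. \<rho> \<in> density_matrices d \<Longrightarrow> \<bar>expectation_value \<rho> H\<bar> \<le> M"
  shows "Re (mat_trace (H ^\<^sub>m (2 ^ m))) \<le> d * M ^ (2 ^ m)"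
proof -
  note cH = hermitian_mats_carrier[OF H]
  \<comment> \<open>The induction needs both signs and all of the cone, because squaring a bound
    uses it from both sides and at conjugated, unnormalised states.\<close>
  have *: "expectation_value \<rho> (H ^\<^sub>m (2 ^ m)) \<le> M ^ (2 ^ m) * Re (mat_trace \<rho>) \<and>
     - (M ^ (2 ^ m) * Re (mat_trace \<rho>)) \<le> expectation_value \<rho> (H ^\<^sub>m (2 ^ m))"
    if "\<rho> \<in> psd_mats d" for \<rho>
    using that
  proof (induction m arbitrary: \<rho>)
    case 0
    have c\<rho>: "\<rho> \<in> carrier_mat d d" by (rule psd_mats_carrier[OF 0])
    have neg: "expectation_value \<sigma> (complex_of_real (- 1) \<cdot>\<^sub>m H) = - expectation_value \<sigma> H"
      if "\<sigma> \<in> carrier_mat d d" for \<sigma>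
      using expectation_smult[OF that cH, of "- 1"] by simp
    have "expectation_value \<rho> H \<le> M * Re (mat_trace \<rho>)"
      using bound by (intro density_matrix_bound_imp_psd_bound[OF assms(1) cH _ 0]) (auto simp: abs_le_iff)
    moreover have "expectation_value \<rho> (complex_of_real (- 1) \<cdot>\<^sub>m H) \<le> M * Re (mat_trace \<rho>)"
    proof (rule density_matrix_bound_imp_psd_bound[OF assms(1) _ _ 0])
      fix \<sigma> assume "\<sigma> \<in> density_matrices d"
      with bound[OF this] show "expectation_value \<sigma> (complex_of_real (- 1) \<cdot>\<^sub>m H) \<le> M"
        by (subst neg) (auto simp: density_matrices_def)
    qed (use cH in auto)
    ultimately show ?case using cH neg[OF c\<rho>] by simp
  next
    case (Suc m)
    have "expectation_value \<rho> (H ^\<^sub>m (2 ^ m) * H ^\<^sub>m (2 ^ m)) \<le> (M ^ (2 ^ m))\<^sup>2 * Re (mat_trace \<rho>)"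
    proof (rule expectation_square_le[OF _ hermitian_mats_pow[OF H] _ _ Suc(2)])
      show "0 < M ^ (2 ^ m)" using assms(2) by simp
    qed (use Suc(1) in auto)
    \<comment> \<open>From the first squaring on, the lower bound is free: the power is a square, so
      its expectation is nonnegative while the lower bound is at most 0.\<close>
    moreover have "0 \<le> expectation_value \<rho> (H ^\<^sub>m (2 ^ m) * H ^\<^sub>m (2 ^ m))"
      by (rule expectation_square_nonneg[OF Suc(2) hermitian_mats_pow[OF H]])
    moreover have "0 \<le> (M ^ (2 ^ m))\<^sup>2 * Re (mat_trace \<rho>)"
      using psd_mats_trace_nonneg[OF Suc(2)] by (simp add: less_eq_complex_def)
    moreover have pw: "(M ^ (2 ^ m))\<^sup>2 = M ^ (2 ^ Suc m)"
      by (simp add: power_mult[symmetric] mult.commute)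
    ultimately show ?case unfolding pow_mat_double[OF cH] pw[symmetric] by linarith
  qed
  from *[OF psd_mats_one] show ?thesis
    using cH by (simp add: expectation_value_def mat_trace_one left_mult_one_mat[of _ d d] mult.commute)
qed

section \<open>Families with prescribed commutation signs\<close>

text \<open>The properties of Pauli strings on which the argument rests: Hermitian involutions that
  commute up to prescribed scalars. The scalars \<open>c\<close> do not refer to the dimension, so
  families on different numbers of qubits can share them.\<close>

definition signed_family ::
  "nat \<Rightarrow> nat \<Rightarrow> (nat \<Rightarrow> nat \<Rightarrow> complex) \<Rightarrow> (nat \<Rightarrow> complex mat) \<Rightarrow> bool" where
  "signed_family d n c S \<longleftrightarrow>
     (\<forall>i<n. S i \<in> hermitian_mats d \<and> S i * S i = 1\<^sub>m d \<and>
        (\<forall>j<n. S i * S j = c i j \<cdot>\<^sub>m (S j * S i)))"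

lemma signed_familyD:
  assumes "signed_family d n c S" "i < n"
  shows "S i \<in> hermitian_mats d" "S i \<in> carrier_mat d d" "S i * S i = 1\<^sub>m d"
    "\<And>j. j < n \<Longrightarrow> S i * S j = c i j \<cdot>\<^sub>m (S j * S i)"
  using assms hermitian_mats_carrier unfolding signed_family_def by blast+

section \<open>Words in a signed family\<close>

primrec word :: "nat \<Rightarrow> (nat \<Rightarrow> complex mat) \<Rightarrow> nat list \<Rightarrow> complex mat" where
  "word d S [] = 1\<^sub>m d"
| "word d S (i # xs) = S i * word d S xs"

lemma word_carrier:
  assumes "\<And>i. i \<in> set xs \<Longrightarrow> S i \<in> carrier_mat d d"
  shows "word d S xs \<in> carrier_mat d d"
  using assms by (induction xs) (auto intro: mult_carrier_mat)

lemma word_append: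
  assumes "\<And>i. i \<in> set (us @ vs) \<Longrightarrow> S i \<in> carrier_mat d d"
  shows "word d S (us @ vs) = word d S us * word d S vs"
  using assms
proof (induction us)
  case Nil
  then show ?case using word_carrier[of vs S d] by simp
next
  case (Cons i us)
  have "word d S us \<in> carrier_mat d d" "word d S vs \<in> carrier_mat d d" "S i \<in> carrier_mat d d"
    using Cons.prems by (auto intro!: word_carrier)
  with Cons show ?case by (simp add: assoc_mult_mat[of _ d d _ d _ d])
qed

lemma smult_smult_mat:
  fixes A :: "'a :: semigroup_mult mat"
  shows "k \<cdot>\<^sub>m (l \<cdot>\<^sub>m A) = (k * l) \<cdot>\<^sub>m A"
  by (auto intro!: eq_matI simp: mult.assoc)

text \<open>Passing \<open>S i\<close> across the word letter by letter collects one factor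
  \<open>c i j\<close> for each letter \<open>j\<close>, so the scalar depends on \<open>c\<close>
  and the letters but not on the matrices.\<close>

lemma word_commute:
  assumes S: "signed_family d n c S" and "i < n" "set us \<subseteq> {..<n}"
  shows "S i * word d S us = prod_list (map (c i) us) \<cdot>\<^sub>m (word d S us * S i)"
  using assms(3)
proof (induction us)
  case Nil
  then show ?case using signed_familyD(2)[OF S assms(2)] by (auto intro!: eq_matI)
next
  case (Cons j us)
  have j: "j < n" using Cons.prems by simp
  note cS = signed_familyD(2)[OF S assms(2)] signed_familyD(2)[OF S j]
  have cW: "word d S us \<in> carrier_mat d d"
    using Cons.prems signed_familyD(2)[OF S] by (intro word_carrier) auto
  have "S i * word d S (j # us) = S i * S j * word d S us"
    using cS cW by (simp add: assoc_mult_mat[of _ d d _ d _ d])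
  also have "\<dots> = c i j \<cdot>\<^sub>m (S j * (S i * word d S us))"
    using cS cW
    by (simp add: signed_familyD(4)[OF S assms(2) j] mult_smult_assoc_mat[of _ d d _ d]
        assoc_mult_mat[of _ d d _ d _ d])
  also have "S i * word d S us = prod_list (map (c i) us) \<cdot>\<^sub>m (word d S us * S i)"
    using Cons by simp
  also have "c i j \<cdot>\<^sub>m (S j * (prod_list (map (c i) us) \<cdot>\<^sub>m (word d S us * S i))) =
      prod_list (map (c i) (j # us)) \<cdot>\<^sub>m (word d S (j # us) * S i)"
    using cS cW by (simp add: mult_smult_distrib[of _ d d _ d] assoc_mult_mat[of _ d d _ d _ d]
        smult_smult_mat)
  finally show ?case .
qed

text \<open>The scalar is obtained by moving equal letters next to each other, so it is the same for
  all families with the same commutation signs.\<close>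

lemma word_even_scalar:
  assumes "set xs \<subseteq> {..<n}" "\<And>i. even (count_list xs i)"
  shows "\<exists>s. \<forall>d S. signed_family d n c S \<longrightarrow> word d S xs = s \<cdot>\<^sub>m 1\<^sub>m d"
  using assms
proof (induction xs rule: length_induct)
  case (1 xs)
  show ?case
  proof (cases xs)
    case Nil
    then show ?thesis by (intro exI[of _ 1]) auto
  next
    case (Cons i ys)
    \<comment> \<open>The leading letter has a partner further on by parity. Moving it there and
      cancelling the square leaves a word shorter by two letters, again with even counts.\<close>
    have "odd (count_list ys i)" using 1(3)[of i] Cons by simp
    then have "i \<in> set ys" by (metis count_notin even_zero)
    then obtain us vs where ys: "ys = us @ i # vs" by (meson split_list)
    have lt: "i < n" "set us \<subseteq> {..<n}" "set vs \<subseteq> {..<n}" using 1(2) Cons ys by auto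
    have "even (count_list (us @ vs) j)" for j
      using 1(3)[of j] Cons ys by (auto split: if_splits)
    then have "\<exists>s. \<forall>d S. signed_family d n c S \<longrightarrow> word d S (us @ vs) = s \<cdot>\<^sub>m 1\<^sub>m d"
      using 1(1) Cons ys lt by auto
    then obtain s where s: "\<And>d S. signed_family d n c S \<Longrightarrow> word d S (us @ vs) = s \<cdot>\<^sub>m 1\<^sub>m d"
      by blast
    have "word d S xs = (prod_list (map (c i) us) * s) \<cdot>\<^sub>m 1\<^sub>m d" if S: "signed_family d n c S" for d S
    proof -
      have cS: "S j \<in> carrier_mat d d" if "j < n" for j by (rule signed_familyD(2)[OF S that])
      have c: "S i \<in> carrier_mat d d" "word d S us \<in> carrier_mat d d" "word d S vs \<in> carrier_mat d d"
        using lt cS by (auto intro!: word_carrier)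
      have "word d S xs = S i * (word d S us * (S i * word d S vs))"
        unfolding Cons ys using lt cS by (subst word.simps, subst word_append) auto
      also have "\<dots> = S i * word d S us * (S i * word d S vs)"
        using c by (simp add: assoc_mult_mat[of _ d d _ d _ d])
      also have "\<dots> = prod_list (map (c i) us) \<cdot>\<^sub>m (word d S us * (S i * S i * word d S vs))"
        unfolding word_commute[OF S lt(1,2)] using c
        by (simp add: mult_smult_assoc_mat[of _ d d _ d] assoc_mult_mat[of _ d d _ d _ d])
      also have "S i * S i * word d S vs = word d S vs"
        using signed_familyD(3)[OF S lt(1)] c by simp
      also have "word d S us * word d S vs = s \<cdot>\<^sub>m 1\<^sub>m d"
        using s[OF S] lt cS by (subst (asm) word_append) auto
      finally show ?thesis by (simp add: smult_smult_mat)
    qed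
    then show ?thesis by blast
  qed
qed

section \<open>Sign patterns, encoded by the set of negative indices, and sums over them\<close>

definition flip :: "nat set \<Rightarrow> nat \<Rightarrow> real" where
  "flip E i = (if i \<in> E then - 1 else 1)"

lemma prod_list_flip:
  "prod_list (map (flip (sym_diff E {i})) xs) = (- 1) ^ count_list xs i * prod_list (map (flip E) xs)"
  by (induction xs) (auto simp: flip_def)

text \<open>Toggling the sign of \<open>i\<close> is an involution on the sign patterns that negates
  every summand when \<open>i\<close> occurs an odd number of times. The sum therefore equals its
  own negative.\<close>

lemma sum_prod_list_flip_odd:
  assumes "odd (count_list xs i)" "i < n"
  shows "(\<Sum>E \<in> Pow {..<n}. prod_list (map (flip E) xs)) = 0"
proof -
  have "(\<Sum>E \<in> Pow {..<n}. prod_list (map (flip E) xs)) =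
      (\<Sum>E \<in> Pow {..<n}. prod_list (map (flip (sym_diff E {i})) xs))"
    using assms(2)
    by (intro sum.reindex_bij_witness[of _ "\<lambda>E. sym_diff E {i}" "\<lambda>E. sym_diff E {i}"])
       (auto intro!: arg_cong[of _ _ "\<lambda>E. prod_list (map (flip E) xs)"])
  also have "\<dots> = - (\<Sum>E \<in> Pow {..<n}. prod_list (map (flip E) xs))"
    unfolding prod_list_flip using assms(1) by (simp add: sum_negf)
  finally show ?thesis by simp
qed

section \<open>Linear combinations of the family and the traces of their powers\<close>

definition lin_comb :: "nat \<Rightarrow> nat \<Rightarrow> (nat \<Rightarrow> complex mat) \<Rightarrow> (nat \<Rightarrow> real) \<Rightarrow> complex mat" where
  "lin_comb d n S a = mat d d (\<lambda>(k, l). \<Sum>i<n. complex_of_real (a i) * S i $$ (k, l))"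

lemma lin_comb_carrier [simp]: "lin_comb d n S a \<in> carrier_mat d d"
  by (simp add: lin_comb_def)

lemma lin_comb_dim [simp]: "dim_row (lin_comb d n S a) = d" "dim_col (lin_comb d n S a) = d"
  by (simp_all add: lin_comb_def)

lemma lin_comb_hermitian:
  assumes "\<And>i. i < n \<Longrightarrow> S i \<in> hermitian_mats d"
  shows "lin_comb d n S a \<in> hermitian_mats d"
proof (rule hermitian_matsI)
  fix k l assume "k < d" "l < d"
  then show "lin_comb d n S a $$ (k, l) = cnj (lin_comb d n S a $$ (l, k))"
    by (auto simp: lin_comb_def hermitian_mats_index[OF assms, symmetric] intro!: sum.cong)
qed simp

lemma trace_lin_comb_mult:
  assumes "\<And>i. i < n \<Longrightarrow> S i \<in> carrier_mat d d" "B \<in> carrier_mat d d"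
  shows "mat_trace (lin_comb d n S a * B) = (\<Sum>i<n. a i * mat_trace (S i * B))"
proof -
  have "mat_trace (lin_comb d n S a * B) =
      (\<Sum>k<d. \<Sum>l<d. \<Sum>i<n. a i * (S i $$ (k, l) * B $$ (l, k)))"
    unfolding mat_trace_mult[OF lin_comb_carrier assms(2)]
    by (auto simp: lin_comb_def sum_distrib_right mult.assoc intro!: sum.cong)
  also have "\<dots> = (\<Sum>k<d. \<Sum>i<n. \<Sum>l<d. a i * (S i $$ (k, l) * B $$ (l, k)))"
    by (intro sum.cong sum.swap refl)
  also have "\<dots> = (\<Sum>i<n. \<Sum>k<d. \<Sum>l<d. a i * (S i $$ (k, l) * B $$ (l, k)))"
    by (rule sum.swap)
  also have "\<dots> = (\<Sum>i<n. a i * mat_trace (S i * B))"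
    using assms by (intro sum.cong) (auto simp: mat_trace_mult[of _ d d] sum_distrib_left)
  finally show ?thesis .
qed

lemma expectation_lin_comb:
  assumes "\<And>i. i < n \<Longrightarrow> S i \<in> carrier_mat d d" "\<rho> \<in> carrier_mat d d"
  shows "expectation_value \<rho> (lin_comb d n S a) = (\<Sum>i<n. a i * expectation_value \<rho> (S i))"
proof -
  have "mat_trace (\<rho> * lin_comb d n S a) = (\<Sum>i<n. a i * mat_trace (\<rho> * S i))"
    unfolding mat_trace_mult_commute[OF assms(2) lin_comb_carrier]
    using assms by (subst trace_lin_comb_mult) (auto simp: mat_trace_mult_commute[of \<rho> d d])
  then show ?thesis by (simp add: expectation_value_def)
qed

abbreviation index_words :: "nat \<Rightarrow> nat \<Rightarrow> nat list set" where
  "index_words n p \<equiv> {xs. set xs \<subseteq> {..<n} \<and> length xs = p}"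

text \<open>The extra factor \<open>B\<close> makes the induction work: one factor of the power is
  expanded, cyclicity carries its \<open>S i\<close> to the right of \<open>B\<close>, and the
  induction hypothesis is applied to \<open>B * S i\<close>. A second rotation puts
  \<open>S i\<close> in front of the word.\<close>

lemma trace_lin_comb_power_mult:
  assumes S: "\<And>i. i < n \<Longrightarrow> S i \<in> carrier_mat d d" and "B \<in> carrier_mat d d"
  shows "mat_trace (lin_comb d n S a ^\<^sub>m p * B) =
    (\<Sum>xs \<in> index_words n p. complex_of_real (prod_list (map a xs)) * mat_trace (word d S xs * B))"
  using assms(2)
proof (induction p arbitrary: B)
  case 0
  have "index_words n 0 = {[]}" by auto
  with 0 show ?case by simp
next
  case (Suc p)
  let ?H = "lin_comb d n S a"
  have inj: "inj_on (\<lambda>(xs, i). i # xs) (index_words n p \<times> {..<n})"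
    by (auto simp: inj_on_def)
  have cHp: "?H ^\<^sub>m p \<in> carrier_mat d d" by simp
  have cw: "word d S xs \<in> carrier_mat d d" if "xs \<in> index_words n p" for xs
    using that S by (intro word_carrier) auto
  have "mat_trace (?H ^\<^sub>m Suc p * B) = mat_trace (?H * (?H ^\<^sub>m p * B))"
    using Suc.prems cHp pow_mat_Suc_left[OF lin_comb_carrier, of d n S a p]
    by (simp add: assoc_mult_mat[of _ d d _ d _ d] del: pow_mat.simps)
  also have "\<dots> = (\<Sum>i<n. a i * mat_trace (S i * (?H ^\<^sub>m p * B)))"
    using cHp Suc.prems by (intro trace_lin_comb_mult S) auto
  also have "\<dots> = (\<Sum>i<n. a i * mat_trace (?H ^\<^sub>m p * (B * S i)))"
  proof (intro sum.cong refl arg_cong2[of _ _ _ _ "(*)"])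
    fix i assume "i \<in> {..<n}"
    then have cS: "S i \<in> carrier_mat d d" using S by simp
    then have "mat_trace (S i * (?H ^\<^sub>m p * B)) = mat_trace (?H ^\<^sub>m p * B * S i)"
      using cHp Suc.prems by (intro mat_trace_mult_commute[of _ d d]) auto
    then show "mat_trace (S i * (?H ^\<^sub>m p * B)) = mat_trace (?H ^\<^sub>m p * (B * S i))"
      using cHp Suc.prems cS by (simp add: assoc_mult_mat[of _ d d _ d _ d])
  qed
  also have "\<dots> = (\<Sum>i<n. a i * (\<Sum>xs \<in> index_words n p. complex_of_real (prod_list (map a xs)) *
      mat_trace (word d S xs * (B * S i))))"
    using Suc.prems S by (intro sum.cong refl arg_cong2[of _ _ _ _ "(*)"] Suc.IH) auto
  also have "\<dots> = (\<Sum>i<n. \<Sum>xs \<in> index_words n p. complex_of_real (prod_list (map a (i # xs))) *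
      mat_trace (word d S (i # xs) * B))"
    unfolding sum_distrib_left
  proof (intro sum.cong refl)
    fix i xs assume i: "i \<in> {..<n}" and xs: "xs \<in> index_words n p"
    have cS: "S i \<in> carrier_mat d d" using S i by simp
    note c = cS cw[OF xs] Suc.prems
    have "mat_trace (word d S xs * (B * S i)) = mat_trace (word d S xs * B * S i)"
      using c by (simp add: assoc_mult_mat[of _ d d _ d _ d])
    also have "\<dots> = mat_trace (S i * (word d S xs * B))"
      using c by (intro mat_trace_mult_commute[of _ d d]) auto
    also have "\<dots> = mat_trace (word d S (i # xs) * B)"
      using c by (simp add: assoc_mult_mat[of _ d d _ d _ d])
    finally show "complex_of_real (a i) * (complex_of_real (prod_list (map a xs)) * mat_trace (word d S xs * (B * S i))) =
        complex_of_real (prod_list (map a (i # xs))) * mat_trace (word d S (i # xs) * B)"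
      by simp
  qed
  also have "\<dots> = (\<Sum>(xs, i) \<in> index_words n p \<times> {..<n}. complex_of_real (prod_list (map a (i # xs))) *
      mat_trace (word d S (i # xs) * B))"
    by (subst sum.swap) (simp add: sum.cartesian_product)
  also have "\<dots> = (\<Sum>xs \<in> index_words n (Suc p). complex_of_real (prod_list (map a xs)) * mat_trace (word d S xs * B))"
    unfolding lists_length_Suc_eq sum.reindex[OF inj] by (simp add: case_prod_unfold)
  finally show ?case .
qed

text \<open>The coefficient of a word splits into its signs and its weights, so exchanging the two
  sums isolates for each word the sum of its signs over all patterns.\<close>

lemma flip_sum_trace_power:
  assumes "\<And>i. i < n \<Longrightarrow> S i \<in> carrier_mat d d"
  shows "(\<Sum>E \<in> Pow {..<n}. mat_trace (lin_comb d n S (\<lambda>i. flip E i * a i) ^\<^sub>m p)) =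
    (\<Sum>xs \<in> index_words n p. complex_of_real (prod_list (map a xs) *
       (\<Sum>E \<in> Pow {..<n}. prod_list (map (flip E) xs))) * mat_trace (word d S xs))"
proof -
  have "mat_trace (lin_comb d n S b ^\<^sub>m p) =
    (\<Sum>xs \<in> index_words n p. complex_of_real (prod_list (map b xs)) * mat_trace (word d S xs))" for b
  proof -
    have "mat_trace (lin_comb d n S b ^\<^sub>m p) = mat_trace (lin_comb d n S b ^\<^sub>m p * 1\<^sub>m d)"
      by (simp add: right_mult_one_mat[of _ d d])
    also have "\<dots> = (\<Sum>xs \<in> index_words n p. complex_of_real (prod_list (map b xs)) * mat_trace (word d S xs * 1\<^sub>m d))"
      using assms by (intro trace_lin_comb_power_mult) auto
    also have "\<dots> = (\<Sum>xs \<in> index_words n p. complex_of_real (prod_list (map b xs)) * mat_trace (word d S xs))"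
    proof (intro sum.cong refl)
      fix xs assume "xs \<in> index_words n p"
      then have "word d S xs \<in> carrier_mat d d" using assms by (intro word_carrier) auto
      then show "complex_of_real (prod_list (map b xs)) * mat_trace (word d S xs * 1\<^sub>m d) =
          complex_of_real (prod_list (map b xs)) * mat_trace (word d S xs)"
        by (simp add: right_mult_one_mat[of _ d d])
    qed
    finally show ?thesis .
  qed
  moreover have "prod_list (map (\<lambda>i. flip E i * a i) xs) =
      prod_list (map (flip E) xs) * prod_list (map a xs)" for E xs
    by (induction xs) (auto simp: algebra_simps)
  ultimately have "(\<Sum>E \<in> Pow {..<n}. mat_trace (lin_comb d n S (\<lambda>i. flip E i * a i) ^\<^sub>m p)) =
      (\<Sum>E \<in> Pow {..<n}. \<Sum>xs \<in> index_words n p.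
         complex_of_real (prod_list (map (flip E) xs) * prod_list (map a xs)) * mat_trace (word d S xs))"
    by simp
  also have "\<dots> = (\<Sum>xs \<in> index_words n p. \<Sum>E \<in> Pow {..<n}.
         complex_of_real (prod_list (map (flip E) xs) * prod_list (map a xs)) * mat_trace (word d S xs))"
    by (rule sum.swap)
  finally show ?thesis
    by (simp add: sum_distrib_left sum_distrib_right mult_ac)
qed

text \<open>A word with an odd count has coefficient 0. Every other word is the same scalar multiple
  of the identity in both families, so its traces differ only by the dimensions, which the
  cross-multiplication compensates.\<close>

lemma flip_sum_trace_power_eq:
  assumes "signed_family d1 n c S1" "signed_family d2 n c S2"
  shows "of_nat d2 * (\<Sum>E \<in> Pow {..<n}. mat_trace (lin_comb d1 n S1 (\<lambda>i. flip E i * a i) ^\<^sub>m p)) =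
    of_nat d1 * (\<Sum>E \<in> Pow {..<n}. mat_trace (lin_comb d2 n S2 (\<lambda>i. flip E i * a i) ^\<^sub>m p))"
proof -
  define f where "f xs = complex_of_real (prod_list (map a xs) *
       (\<Sum>E \<in> Pow {..<n}. prod_list (map (flip E) xs)))" for xs
  have "f xs * (of_nat d2 * mat_trace (word d1 S1 xs)) = f xs * (of_nat d1 * mat_trace (word d2 S2 xs))"
    if "xs \<in> index_words n p" for xs
  proof (cases "\<forall>i. even (count_list xs i)")
    case True
    with that have "\<exists>s. \<forall>d S. signed_family d n c S \<longrightarrow> word d S xs = s \<cdot>\<^sub>m 1\<^sub>m d"
      by (intro word_even_scalar) auto
    then obtain s where "\<And>d S. signed_family d n c S \<Longrightarrow> word d S xs = s \<cdot>\<^sub>m 1\<^sub>m d"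
      by blast
    with assms show ?thesis
      by (simp add: mat_trace_smult[OF one_carrier_mat] mat_trace_one)
  next
    case False
    then obtain i where i: "odd (count_list xs i)" by blast
    then have "i \<in> set xs" by (metis count_notin even_zero)
    with that have "i < n" by auto
    with i show ?thesis by (simp add: f_def sum_prod_list_flip_odd)
  qed
  then have "(\<Sum>xs \<in> index_words n p. f xs * (of_nat d2 * mat_trace (word d1 S1 xs))) =
      (\<Sum>xs \<in> index_words n p. f xs * (of_nat d1 * mat_trace (word d2 S2 xs)))"
    by (rule sum.cong[OF refl])
  moreover have "(\<Sum>E \<in> Pow {..<n}. mat_trace (lin_comb d n S (\<lambda>i. flip E i * a i) ^\<^sub>m p)) =
      (\<Sum>xs \<in> index_words n p. f xs * mat_trace (word d S xs))" if "signed_family d n c S" for d S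
    unfolding f_def using signed_familyD(2)[OF that] by (rule flip_sum_trace_power)
  ultimately show ?thesis
    using assms by (simp add: sum_distrib_left mult.left_commute)
qed

text \<open>One implication of the theorem in terms of signed families; exchanging the two families
  gives the converse.\<close>

lemma quadratic_bound_transfer:
  fixes w :: "nat \<Rightarrow> real"
  assumes "d1 > 0" and S1: "signed_family d1 n c S1" and S2: "signed_family d2 n c S2"
    and w: "\<And>i. i < n \<Longrightarrow> w i > 0"
    and bound: "\<And>\<rho>. \<rho> \<in> density_matrices d1 \<Longrightarrow>
      (\<Sum>i<n. w i * (expectation_value \<rho> (S1 i))\<^sup>2) \<le> r\<^sup>2"
    and \<rho>: "\<rho> \<in> density_matrices d2"
  shows "(\<Sum>i<n. w i * (expectation_value \<rho> (S2 i))\<^sup>2) \<le> r\<^sup>2"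
proof (rule ccontr)
  define x where "x i = expectation_value \<rho> (S2 i)" for i
  define q where "q = (\<Sum>i<n. w i * (x i)\<^sup>2)"
  define a where "a i = w i * x i" for i
  \<comment> \<open>The midpoint of \<open>r\<^sup>2\<close> and \<open>q\<close> is strictly below
    \<open>q\<close>, and it is positive even for \<open>r = 0\<close>, as required by
    \<open>trace_power_le\<close>.\<close>
  define M where "M = (q + r\<^sup>2) / 2"
  define H1 where "H1 E = lin_comb d1 n S1 (\<lambda>i. flip E i * a i)" for E
  define H2 where "H2 E = lin_comb d2 n S2 (\<lambda>i. flip E i * a i)" for E
  assume "\<not> ?thesis"
  then have q: "r\<^sup>2 < q" by (simp add: q_def x_def)
  then have "q > 0" by (meson le_less_trans zero_le_power2)
  have M: "M > 0" "M < q" using q \<open>q > 0\<close> by (auto simp: M_def add_pos_nonneg)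
  have c\<rho>: "\<rho> \<in> carrier_mat d2 d2" using \<rho> by (simp add: density_matrices_def)
  have H1: "H1 E \<in> hermitian_mats d1" and H2: "H2 E \<in> hermitian_mats d2" for E
    unfolding H1_def H2_def using signed_familyD(1)[OF S1] signed_familyD(1)[OF S2]
    by (auto intro!: lin_comb_hermitian)
  \<comment> \<open>Absolute values remove the signs. The weighted form of
    \<open>2 x y \<le> x\<^sup>2 + y\<^sup>2\<close> then separates \<open>q\<close>, coming from
    \<open>x\<close>, from the quadratic form at \<open>\<sigma>\<close>, to which
    \<open>bound\<close> applies.\<close>
  have "\<bar>expectation_value \<sigma> (H1 E)\<bar> \<le> M" if "\<sigma> \<in> density_matrices d1" for \<sigma> E
  proof -
    define y where "y i = expectation_value \<sigma> (S1 i)" for i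
    have "\<sigma> \<in> carrier_mat d1 d1" using that by (simp add: density_matrices_def)
    then have "expectation_value \<sigma> (H1 E) = (\<Sum>i<n. flip E i * a i * y i)"
      unfolding H1_def y_def using signed_familyD(2)[OF S1] by (intro expectation_lin_comb) auto
    also have "\<bar>\<dots>\<bar> \<le> (\<Sum>i<n. \<bar>flip E i * a i * y i\<bar>)" by (rule sum_abs)
    also have "\<dots> \<le> (\<Sum>i<n. (w i * (x i)\<^sup>2 + w i * (y i)\<^sup>2) / 2)"
    proof (intro sum_mono)
      fix i assume "i \<in> {..<n}"
      then have "w i > 0" using w by simp
      have "\<bar>flip E i * a i * y i\<bar> = w i * (\<bar>x i\<bar> * \<bar>y i\<bar>)"
        using \<open>w i > 0\<close> by (simp add: flip_def a_def abs_mult)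
      also have "\<dots> \<le> w i * (((x i)\<^sup>2 + (y i)\<^sup>2) / 2)"
        using \<open>w i > 0\<close> sum_squares_bound[of "\<bar>x i\<bar>" "\<bar>y i\<bar>"] by (intro mult_left_mono) auto
      finally show "\<bar>flip E i * a i * y i\<bar> \<le> (w i * (x i)\<^sup>2 + w i * (y i)\<^sup>2) / 2"
        by (simp add: algebra_simps)
    qed
    also have "\<dots> = (q + (\<Sum>i<n. w i * (y i)\<^sup>2)) / 2"
      by (simp add: q_def sum.distrib sum_divide_distrib add_divide_distrib)
    also have "\<dots> \<le> M"
      using bound[OF that] by (simp add: M_def y_def)
    finally show ?thesis .
  qed
  then have tr1: "Re (mat_trace (H1 E ^\<^sub>m (2 ^ m))) \<le> d1 * M ^ (2 ^ m)" for E m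
    using trace_power_le[OF assms(1) M(1) H1] by blast
  obtain C where C: "C \<ge> 0" "\<And>B. B \<in> hermitian_mats d2 \<Longrightarrow>
      expectation_value \<rho> (B * B) \<le> C * Re (mat_trace (B * B))"
    using expectation_square_le_trace[OF c\<rho>] by blast
  have "flip {} i = 1" for i by (simp add: flip_def)
  then have "expectation_value \<rho> (H2 {}) = (\<Sum>i<n. a i * x i)"
    unfolding H2_def x_def using signed_familyD(2)[OF S2] c\<rho> by (simp add: expectation_lin_comb)
  then have qE: "expectation_value \<rho> (H2 {}) = q"
    by (simp add: q_def a_def power2_eq_square mult.assoc)
  \<comment> \<open>The factors independent of the exponent: the constant for \<open>\<rho>\<close>,
    the dimension of the second family, and the number of sign patterns. The dimension
    \<open>d1\<close> cancels.\<close>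
  define K where "K = C * d2 * 2 ^ n"
  \<comment> \<open>The exponent is \<open>2 ^ Suc m\<close>, hence even: every
    \<open>H2 E ^\<^sub>m p\<close> is the square of a Hermitian matrix, which makes its trace
    nonnegative and lets the bound with \<open>C\<close> apply.\<close>
  have growth: "q ^ (2 ^ Suc m) \<le> K * M ^ (2 ^ Suc m)" for m
  proof -
    define p :: nat where "p = 2 ^ Suc m"
    have sq: "H2 E ^\<^sub>m p = H2 E ^\<^sub>m (2 ^ m) * H2 E ^\<^sub>m (2 ^ m)" for E
      unfolding p_def by (rule pow_mat_double[OF hermitian_mats_carrier[OF H2]])
    have nonneg: "0 \<le> Re (mat_trace (H2 E ^\<^sub>m p))" for E
      unfolding sq hermitian_trace_square[OF hermitian_mats_pow[OF H2]]
      by (auto intro!: sum_nonneg)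
    have "q ^ p \<le> expectation_value \<rho> (H2 {} ^\<^sub>m p)"
      using expectation_power_ge[OF \<rho> H2, of "{}" "Suc m"] \<open>q > 0\<close> by (simp only: qE p_def)
    also have "\<dots> \<le> C * Re (mat_trace (H2 {} ^\<^sub>m p))"
      unfolding sq by (rule C(2)[OF hermitian_mats_pow[OF H2]])
    \<comment> \<open>Only the unflipped pattern is tied to \<open>q\<close>; the other traces are
      nonnegative, so they may be added to reach the sum common to both families.\<close>
    also have "\<dots> \<le> C * (\<Sum>E \<in> Pow {..<n}. Re (mat_trace (H2 E ^\<^sub>m p)))"
      using nonneg by (intro mult_left_mono[OF _ C(1)] member_le_sum) auto
    finally have "d1 * q ^ p \<le> C * (d1 * (\<Sum>E \<in> Pow {..<n}. Re (mat_trace (H2 E ^\<^sub>m p))))"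
      using assms(1) by (simp add: mult.left_commute)
    also have "d1 * (\<Sum>E \<in> Pow {..<n}. Re (mat_trace (H2 E ^\<^sub>m p))) =
        d2 * (\<Sum>E \<in> Pow {..<n}. Re (mat_trace (H1 E ^\<^sub>m p)))"
      using arg_cong[OF flip_sum_trace_power_eq[OF S1 S2, of a p], of Re]
      by (simp add: H1_def H2_def)
    also have "\<dots> \<le> d2 * (\<Sum>E \<in> Pow {..<n}. d1 * M ^ p)"
      unfolding p_def by (intro mult_left_mono sum_mono tr1) auto
    finally have "d1 * q ^ p \<le> C * (d2 * (\<Sum>E \<in> Pow {..<n}. d1 * M ^ p))"
      using C(1) by (simp add: mult_left_mono)
    then have "d1 * q ^ p \<le> d1 * (K * M ^ p)"
      by (simp add: K_def card_Pow mult_ac)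
    then show ?thesis using assms(1) by (simp add: p_def)
  qed
  have "1 < q / M" using M by simp
  \<comment> \<open>Growth would bound the powers \<open>(q / M) ^ (2 ^ Suc m)\<close> by
    \<open>K\<close> for all \<open>m\<close>, although the ratio exceeds 1.\<close>
  then obtain m where "K < (q / M) ^ m" using real_arch_pow by blast
  also have "\<dots> \<le> (q / M) ^ (2 ^ Suc m)"
    using \<open>1 < q / M\<close> less_exp[of "Suc m"] by (intro power_increasing) auto
  also have "\<dots> \<le> K"
    using growth[of m] M(1) by (simp add: power_divide divide_le_eq)
  finally show False by simp
qed

section \<open>Pauli strings form signed families\<close>

lemma sum_div_mod:
  fixes g :: "nat \<Rightarrow> nat \<Rightarrow> 'a :: comm_monoid_add"
  shows "(\<Sum>t<n * l. g (t div l) (t mod l)) = (\<Sum>a<n. \<Sum>b<l. g a b)"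
proof -
  have "(\<Sum>t<n * l. g (t div l) (t mod l)) = (\<Sum>a<n. \<Sum>t = a * l..<a * l + l. g (t div l) (t mod l))"
    by (simp add: sum.nat_group)
  also have "\<dots> = (\<Sum>a<n. \<Sum>b<l. g a b)"
    by (rule sum.cong[OF refl]) (subst sum.atLeastLessThan_shift_0, simp add: lessThan_atLeast0)
  finally show ?thesis .
qed

lemma kron_carrier:
  assumes "A \<in> carrier_mat m n" "B \<in> carrier_mat k l"
  shows "kron A B \<in> carrier_mat (m * k) (n * l)"
  using assms by (auto simp: kron_def)

lemma kron_index:
  assumes "A \<in> carrier_mat m n" "B \<in> carrier_mat k l" "i < m * k" "j < n * l"
  shows "kron A B $$ (i, j) = A $$ (i div k, j div l) * B $$ (i mod k, j mod l)"
  using assms by (auto simp: kron_def)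

lemma div_mod_less:
  fixes i k m :: nat
  assumes "i < m * k"
  shows "i div k < m" "i mod k < k"
proof -
  have "k > 0" using assms by (intro gr0I) auto
  with assms show "i div k < m" "i mod k < k" by (simp_all add: less_mult_imp_div_less)
qed

text \<open>Quotient and remainder split the inner summation index into a pair, and the resulting
  double sum is a product of two entries.\<close>

lemma kron_mult:
  fixes A :: "'a :: comm_semiring_0 mat"
  assumes A: "A \<in> carrier_mat m n" and B: "B \<in> carrier_mat k l"
    and C: "C \<in> carrier_mat n p" and D: "D \<in> carrier_mat l q"
  shows "kron A B * kron C D = kron (A * C) (B * D)"
proof (rule eq_matI)
  note AB = kron_carrier[OF A B] and CD = kron_carrier[OF C D]
  have AC: "A * C \<in> carrier_mat m p" and BD: "B * D \<in> carrier_mat k q" using A B C D by auto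
  note ACBD = kron_carrier[OF AC BD]
  show "dim_row (kron A B * kron C D) = dim_row (kron (A * C) (B * D))"
    "dim_col (kron A B * kron C D) = dim_col (kron (A * C) (B * D))"
    using AB CD ACBD by auto
  fix i j assume "i < dim_row (kron (A * C) (B * D))" "j < dim_col (kron (A * C) (B * D))"
  then have ij: "i < m * k" "j < p * q" using ACBD by auto
  have "(kron A B * kron C D) $$ (i, j) = (\<Sum>t<n * l. kron A B $$ (i, t) * kron C D $$ (t, j))"
    using AB CD ij by (auto simp: scalar_prod_def lessThan_atLeast0)
  also have "\<dots> = (\<Sum>t<n * l. (A $$ (i div k, t div l) * C $$ (t div l, j div q)) *
      (B $$ (i mod k, t mod l) * D $$ (t mod l, j mod q)))"
    using ij by (intro sum.cong) (auto simp: kron_index[OF A B] kron_index[OF C D] mult_ac)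
  also have "\<dots> = (\<Sum>a<n. \<Sum>b<l. (A $$ (i div k, a) * C $$ (a, j div q)) *
      (B $$ (i mod k, b) * D $$ (b, j mod q)))"
    by (rule sum_div_mod)
  also have "\<dots> = (A * C) $$ (i div k, j div q) * (B * D) $$ (i mod k, j mod q)"
    using A B C D div_mod_less[OF ij(1)] div_mod_less[OF ij(2)]
    by (simp add: scalar_prod_def lessThan_atLeast0 sum_product)
  also have "\<dots> = kron (A * C) (B * D) $$ (i, j)"
    using kron_index[OF AC BD ij] by simp
  finally show "(kron A B * kron C D) $$ (i, j) = kron (A * C) (B * D) $$ (i, j)" .
qed

lemma kron_smult:
  fixes A :: "'a :: comm_semiring_0 mat"
  shows "kron (s \<cdot>\<^sub>m A) (t \<cdot>\<^sub>m B) = (s * t) \<cdot>\<^sub>m kron A B"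
  by (auto simp: kron_def div_mod_less mult_ac intro!: eq_matI)

lemma kron_one: "kron (1\<^sub>m m) (1\<^sub>m k) = (1\<^sub>m (m * k) :: 'a :: semiring_1 mat)"
proof (rule eq_matI)
  fix i j assume "i < dim_row (1\<^sub>m (m * k) :: 'a mat)" "j < dim_col (1\<^sub>m (m * k) :: 'a mat)"
  then have ij: "i < m * k" "j < m * k" by auto
  have "i = j" if "i div k = j div k" "i mod k = j mod k"
    using that by (metis div_mult_mod_eq)
  with ij show "kron (1\<^sub>m m) (1\<^sub>m k) $$ (i, j) = (1\<^sub>m (m * k) :: 'a mat) $$ (i, j)"
    using div_mod_less[OF ij(1)] div_mod_less[OF ij(2)]
    by (auto simp: kron_index[OF one_carrier_mat one_carrier_mat])
qed (auto simp: kron_def)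

lemma kron_hermitian:
  assumes "A \<in> hermitian_mats m" "B \<in> hermitian_mats k"
  shows "kron A B \<in> hermitian_mats (m * k)"
proof (rule hermitian_matsI)
  note c = hermitian_mats_carrier[OF assms(1)] hermitian_mats_carrier[OF assms(2)]
  show "kron A B \<in> carrier_mat (m * k) (m * k)" by (rule kron_carrier[OF c])
  fix i j assume ij: "i < m * k" "j < m * k"
  show "kron A B $$ (i, j) = cnj (kron A B $$ (j, i))"
    using div_mod_less[OF ij(1)] div_mod_less[OF ij(2)] ij
    by (simp add: kron_index[OF c] hermitian_mats_index[OF assms(1), symmetric]
        hermitian_mats_index[OF assms(2), symmetric])
qed

section \<open>Pauli matrices and Pauli strings\<close>

abbreviation paulis :: "complex mat set" where
  "paulis \<equiv> {1\<^sub>m 2, pauli_X, pauli_Y, pauli_Z}"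

lemmas pauli_defs = pauli_X_def pauli_Y_def pauli_Z_def mat_of_rows_list_def

lemma pauli_hermitian: "P \<in> paulis \<Longrightarrow> P \<in> hermitian_mats 2"
  by (auto intro!: hermitian_matsI simp: pauli_defs less_2_cases_iff)

lemma pauli_square:
  assumes "P \<in> paulis"
  shows "P * P = 1\<^sub>m 2"
  using assms by (auto intro!: eq_matI simp: pauli_defs less_2_cases_iff less_Suc_eq scalar_prod_def)

text \<open>Equal matrices commute, and so does the identity with everything; the six ordered pairs
  of distinct nontrivial Pauli matrices anticommute by direct computation.\<close>

lemma pauli_commute_sign:
  assumes "P \<in> paulis" "Q \<in> paulis"
  obtains s :: complex where "s = 1 \<or> s = - 1" "P * Q = s \<cdot>\<^sub>m (Q * P)"
proof -
  have "P * Q = 1 \<cdot>\<^sub>m (Q * P) \<or> P * Q = (- 1) \<cdot>\<^sub>m (Q * P)"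
  proof (cases "P = Q \<or> P = 1\<^sub>m 2 \<or> Q = 1\<^sub>m 2")
    case True
    moreover have "P \<in> carrier_mat 2 2" "Q \<in> carrier_mat 2 2"
      using assms by (auto intro: hermitian_mats_carrier pauli_hermitian)
    ultimately have "P * Q = Q * P"
      using left_mult_one_mat right_mult_one_mat by metis
    moreover have "Q * P = 1 \<cdot>\<^sub>m (Q * P)" by (auto intro!: eq_matI)
    ultimately show ?thesis by simp
  next
    case False
    have "pauli_X * pauli_Y = (- 1) \<cdot>\<^sub>m (pauli_Y * pauli_X)"
      "pauli_Y * pauli_X = (- 1) \<cdot>\<^sub>m (pauli_X * pauli_Y)"
      "pauli_X * pauli_Z = (- 1) \<cdot>\<^sub>m (pauli_Z * pauli_X)"
      "pauli_Z * pauli_X = (- 1) \<cdot>\<^sub>m (pauli_X * pauli_Z)"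
      "pauli_Y * pauli_Z = (- 1) \<cdot>\<^sub>m (pauli_Z * pauli_Y)"
      "pauli_Z * pauli_Y = (- 1) \<cdot>\<^sub>m (pauli_Y * pauli_Z)"
      by (auto intro!: eq_matI simp: pauli_defs less_2_cases_iff less_Suc_eq scalar_prod_def)
    with False assms have "P * Q = (- 1) \<cdot>\<^sub>m (Q * P)"
      by blast
    then show ?thesis by simp
  qed
  with that show thesis by blast
qed

lemma kron_list_simps:
  "kron_list [] = 1\<^sub>m 1" "kron_list (P # Ps) = kron P (kron_list Ps)"
  by (simp_all add: kron_list_def)

lemma kron_list_hermitian:
  "set Ps \<subseteq> paulis \<Longrightarrow> kron_list Ps \<in> hermitian_mats (2 ^ length Ps)"
proof (induction Ps)
  case Nil
  show ?case using hermitian_mats_one[of 1] by (simp add: kron_list_simps)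
next
  case (Cons P Ps)
  then have "P \<in> hermitian_mats 2" by (intro pauli_hermitian) auto
  with Cons show ?case by (auto simp: kron_list_simps intro!: kron_hermitian)
qed

lemma kron_list_square:
  "set Ps \<subseteq> paulis \<Longrightarrow> kron_list Ps * kron_list Ps = 1\<^sub>m (2 ^ length Ps)"
proof (induction Ps)
  case Nil
  show ?case by (simp add: kron_list_simps)
next
  case (Cons P Ps)
  have P: "P \<in> paulis" and Ps: "set Ps \<subseteq> paulis" using Cons.prems by auto
  note c = hermitian_mats_carrier[OF pauli_hermitian[OF P]]
    hermitian_mats_carrier[OF kron_list_hermitian[OF Ps]]
  show ?case
    by (simp only: kron_list_simps kron_mult[OF c c] pauli_square[OF P] Cons.IH[OF Ps] kron_one) simp
qed

text \<open>Products are taken factor by factor, so the signs of the single qubits multiply.\<close>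

lemma kron_list_commute_sign:
  assumes "length Ps = length Qs" "set Ps \<subseteq> paulis" "set Qs \<subseteq> paulis"
  shows "\<exists>s::complex. (s = 1 \<or> s = - 1) \<and> kron_list Ps * kron_list Qs = s \<cdot>\<^sub>m (kron_list Qs * kron_list Ps)"
  using assms
proof (induction Ps Qs rule: list_induct2)
  case Nil
  show ?case by (intro exI[of _ 1]) (auto simp: kron_list_simps intro!: eq_matI)
next
  case (Cons P Ps Q Qs)
  have P: "P \<in> paulis" "set Ps \<subseteq> paulis" and Q: "Q \<in> paulis" "set Qs \<subseteq> paulis"
    using Cons.prems by auto
  note cP = hermitian_mats_carrier[OF pauli_hermitian[OF P(1)]]
    hermitian_mats_carrier[OF kron_list_hermitian[OF P(2)]]
  note cQ = hermitian_mats_carrier[OF pauli_hermitian[OF Q(1)]]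
    hermitian_mats_carrier[OF kron_list_hermitian[OF Q(2)], folded Cons.hyps]
  obtain s :: complex where s: "s = 1 \<or> s = - 1" "P * Q = s \<cdot>\<^sub>m (Q * P)"
    by (rule pauli_commute_sign[OF P(1) Q(1)])
  obtain t :: complex where t: "t = 1 \<or> t = - 1"
    "kron_list Ps * kron_list Qs = t \<cdot>\<^sub>m (kron_list Qs * kron_list Ps)"
    using Cons.IH[OF P(2) Q(2)] by blast
  have "kron_list (P # Ps) * kron_list (Q # Qs) = (s * t) \<cdot>\<^sub>m (kron_list (Q # Qs) * kron_list (P # Ps))"
    by (simp only: kron_list_simps kron_mult[OF cP cQ] kron_mult[OF cQ cP] s(2) t(2) kron_smult)
  moreover have "s * t = 1 \<or> s * t = - 1" using s(1) t(1) by auto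
  ultimately show ?case by blast
qed

section \<open>Commutation signs read off the frustration graph\<close>

definition graph_sign :: "nat set \<times> nat set set \<Rightarrow> nat \<Rightarrow> nat \<Rightarrow> complex" where
  "graph_sign G i j = (if {i, j} \<in> snd G then - 1 else 1)"

text \<open>An unordered edge may be witnessed by its endpoints in either order, which is harmless
  because anticommutation is symmetric.\<close>

lemma frustration_graph_edge_iff:
  fixes S :: "'a :: ring mat list"
  assumes "i < length S" "j < length S"
  shows "{i, j} \<in> snd (frustration_graph S) \<longleftrightarrow> i \<noteq> j \<and> anticommute (S ! i) (S ! j)"
proof -
  have sym: "anticommute (S ! j) (S ! i)" if "anticommute (S ! i) (S ! j)" for i j
    using that unfolding anticommute_def by (metis uminus_uminus_mat)
  show ?thesis
    unfolding frustration_graph_def using assms sym by (auto simp: doubleton_eq_iff)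
qed

text \<open>Two Pauli strings commute up to a sign, so those that do not anticommute do commute, and
  the graph determines the sign. On the diagonal \<open>graph_sign\<close> is 1, since edges have
  distinct endpoints.\<close>

lemma pauli_strings_signed_family:
  assumes "set S \<subseteq> pauli_strings q"
  shows "signed_family (2 ^ q) (length S) (graph_sign (frustration_graph S)) (\<lambda>i. S ! i)"
proof -
  have Ps: "\<exists>Ps. S ! i = kron_list Ps \<and> length Ps = q \<and> set Ps \<subseteq> paulis" if "i < length S" for i
    using assms nth_mem[OF that] by (auto simp: pauli_strings_def)
  have comm: "S ! i * S ! j = graph_sign (frustration_graph S) i j \<cdot>\<^sub>m (S ! j * S ! i)"
    if i: "i < length S" and j: "j < length S" for i j
  proof -
    have smult: "1 \<cdot>\<^sub>m A = A" "(- 1) \<cdot>\<^sub>m A = - A" for A :: "complex mat"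
      by (auto intro!: eq_matI)
    obtain s :: complex where "s = 1 \<or> s = - 1" "S ! i * S ! j = s \<cdot>\<^sub>m (S ! j * S ! i)"
      using Ps[OF i] Ps[OF j] kron_list_commute_sign by metis
    then show ?thesis
      using frustration_graph_edge_iff[OF i j]
      by (auto simp: graph_sign_def anticommute_def smult)
  qed
  have "S ! i \<in> hermitian_mats (2 ^ q) \<and> S ! i * S ! i = 1\<^sub>m (2 ^ q)" if "i < length S" for i
    using Ps[OF that] kron_list_hermitian kron_list_square by metis
  with comm show ?thesis unfolding signed_family_def by blast
qed

section \<open>Reduction of the theorem to bounds on a quadratic form\<close>

lemma ellipsoid_superset_iff:
  assumes "w \<in> carrier_vec (length S)"
  shows "joint_expectations q S \<subseteq> ellipsoid r w \<longleftrightarrow>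
    (\<forall>\<rho> \<in> density_matrices (2 ^ q). (\<Sum>i<length S. w $ i * (expectation_value \<rho> (S ! i))\<^sup>2) \<le> r\<^sup>2)"
  using assms by (auto simp: joint_expectations_def ellipsoid_def)

theorem proposition1:
  fixes n q1 q2 :: nat and S1 S2 :: "complex mat list"
  assumes "set S1 \<subseteq> pauli_strings q1" and "distinct S1" and "length S1 = n"
    and "set S2 \<subseteq> pauli_strings q2" and "distinct S2" and "length S2 = n"
    and "frustration_graph S1 = frustration_graph S2"
  shows "\<forall>(r::real) (w::real vec).
           r \<ge> 0 \<longrightarrow> w \<in> carrier_vec n \<longrightarrow> (\<forall>i<n. w $ i > 0) \<longrightarrow>
             (ellipsoid r w \<supseteq> joint_expectations q1 S1 \<longleftrightarrow>
              ellipsoid r w \<supseteq> joint_expectations q2 S2)"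
proof (intro allI impI)
  fix r :: real and w :: "real vec"
  assume w: "w \<in> carrier_vec n" "\<forall>i<n. w $ i > 0"
  \<comment> \<open>Equality of the frustration graphs enters here: the signs read off the first
    graph also serve the second family.\<close>
  define c where "c = graph_sign (frustration_graph S1)"
  have S1: "signed_family (2 ^ q1) n c (\<lambda>i. S1 ! i)" and S2: "signed_family (2 ^ q2) n c (\<lambda>i. S2 ! i)"
    using pauli_strings_signed_family[OF assms(1)] pauli_strings_signed_family[OF assms(4)] assms
    by (simp_all add: c_def)
  have "w \<in> carrier_vec (length S1)" "w \<in> carrier_vec (length S2)" using w assms by auto
  note iff = this[THEN ellipsoid_superset_iff, unfolded assms(3,6)]
  show "ellipsoid r w \<supseteq> joint_expectations q1 S1 \<longleftrightarrow> ellipsoid r w \<supseteq> joint_expectations q2 S2"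
    unfolding iff
  proof (intro iffI ballI)
    fix \<rho> assume "\<forall>\<rho> \<in> density_matrices (2 ^ q1). (\<Sum>i<n. w $ i * (expectation_value \<rho> (S1 ! i))\<^sup>2) \<le> r\<^sup>2"
      "\<rho> \<in> density_matrices (2 ^ q2)"
    with w(2) show "(\<Sum>i<n. w $ i * (expectation_value \<rho> (S2 ! i))\<^sup>2) \<le> r\<^sup>2"
      by (intro quadratic_bound_transfer[OF _ S1 S2]) auto
  next
    fix \<rho> assume "\<forall>\<rho> \<in> density_matrices (2 ^ q2). (\<Sum>i<n. w $ i * (expectation_value \<rho> (S2 ! i))\<^sup>2) \<le> r\<^sup>2"
      "\<rho> \<in> density_matrices (2 ^ q1)"
    with w(2) show "(\<Sum>i<n. w $ i * (expectation_value \<rho> (S1 ! i))\<^sup>2) \<le> r\<^sup>2"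
      by (intro quadratic_bound_transfer[OF _ S2 S1]) auto
  qed
qed

end
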